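(* Let $n\ge 1$ and let $\mathcal{W}_n\subset \mathcal{B}_n$ be the set of all woven braids on $n$ strings. Every conjugacy class of the braid group $\mathcal{B}_n$ contains at least one element of $\mathcal{W}_n$; that is, for every $\beta\in\mathcal{B}_n$ there is $\gamma\in\mathcal{B}_n$ with $\gamma^{-1}\beta\gamma\in\mathcal{W}_n$.
   Context: $\mathcal{B}_n$ is the braid group on $n$ strings with the usual generators $\sigma_1,\dots,\sigma_{n-1}$ (in $\sigma_i$ the $i$th string passes over the $(i+1)$st). For $1\le i<j\le n$ put $A_{ij}:=\sigma_{j-1}\cdots\sigma_{i+1}\,\sigma_i^{2}\,\sigma_{i+1}^{-1}\cdots\sigma_{j-1}^{-1}$. The pure braid group is $\mathcal{P}_n=\langle A_{ij}: 1\le i<j\le n\rangle$, and for $1\le j\le n$, $\mathcal{P}_n^{j}:=\langle A_{ij}: 1\le i<j\rangle$ is the group of pure $j$-braids ($\mathcal{P}_n^1$ is trivial). For positive integers $n_1,\dots,n_k$ with $n_1+\cdots+n_k=n$, let $\pi_{n_1n_2\ldots n_k}$ be the product, in increasing order of index, of all $\sigma_i$ with $1\le i\le n-1$ and $i\notin\{n_1,\,n_1+n_2,\,\dots,\,n_1+\cdots+n_{k-1}\}$. A braid in $\mathcal{B}_n$ is called woven with $k$ components of type $(n_1,\dots,n_k)$, where $n=n_1+\cdots+n_k$, if it can be written as $\pi_{n_1\ldots n_k}\,\beta_{n_1}\,\beta_{n_1+n_2}\cdots\beta_{n_1+\cdots+n_k}$ with each $\beta_i\in\mathcal{P}_n^{i}$.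 $\mathcal{W}_n^k$ is the set of woven braids on $n$ strings with $k$ components (of any type $(n_1,\dots,n_k)$), and $\mathcal{W}_n:=\bigcup_{k=1}^n\mathcal{W}_n^k$. *)

theory Defs
  imports "HOL-Algebra.Generated_Groups"
begin

text \<open>
  The braid group on \<open>n\<close> strings is given by Artin's presentation.  The letter \<open>(i, True)\<close>
  stands for the generator \<open>\<sigma>\<^sub>i\<close> and \<open>(i, False)\<close> for its inverse, with \<open>1 \<le> i < n\<close>.
\<close>

type_synonym braid_word = "(nat \<times> bool) list"

definition braid_words :: "nat \<Rightarrow> braid_word set" where
  "braid_words n = lists ({1..<n} \<times> UNIV)"

inductive braid_equiv :: "nat \<Rightarrow> braid_word \<Rightarrow> braid_word \<Rightarrow> bool" for n :: nat where
  refl: "w \<in> braid_words n \<Longrightarrow> braid_equiv n w w"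
| sym: "braid_equiv n u v \<Longrightarrow> braid_equiv n v u"
| trans: "braid_equiv n u v \<Longrightarrow> braid_equiv n v w \<Longrightarrow> braid_equiv n u w"
| append: "braid_equiv n u u' \<Longrightarrow> braid_equiv n v v' \<Longrightarrow> braid_equiv n (u @ v) (u' @ v')"
| cancel: "i \<in> {1..<n} \<Longrightarrow> braid_equiv n [(i, b), (i, \<not> b)] []"
| commute: "i \<in> {1..<n} \<Longrightarrow> j \<in> {1..<n} \<Longrightarrow> i + 2 \<le> j \<Longrightarrow>
    braid_equiv n [(i, True), (j, True)] [(j, True), (i, True)]"
| braid: "i \<in> {1..<n} \<Longrightarrow> Suc i \<in> {1..<n} \<Longrightarrow>
    braid_equiv n [(i, True), (Suc i, True), (i, True)] [(Suc i, True), (i, True), (Suc i, True)]"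

definition braid_rel :: "nat \<Rightarrow> (braid_word \<times> braid_word) set" where
  "braid_rel n = {(u, v). braid_equiv n u v}"

definition braid_group :: "nat \<Rightarrow> braid_word set monoid" where
  "braid_group n =
    \<lparr>carrier = braid_words n // braid_rel n,
     mult = (\<lambda>X Y. \<Union>u\<in>X. \<Union>v\<in>Y. braid_rel n `` {u @ v}),
     one = braid_rel n `` {[]}\<rparr>"

definition braid_gen :: "nat \<Rightarrow> nat \<Rightarrow> braid_word set" where
  "braid_gen n i = braid_rel n `` {[(i, True)]}"

definition list_mult :: "('a, 'b) monoid_scheme \<Rightarrow> 'a list \<Rightarrow> 'a" where
  "list_mult G xs = foldr (mult G) xs \<one>\<^bsub>G\<^esub>"

definition pure_gen :: "nat \<Rightarrow> nat \<Rightarrow> nat \<Rightarrow> braid_word set" where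
  "pure_gen n i j =
     list_mult (braid_group n) (map (braid_gen n) (rev [i + 1..<j]))
     \<otimes>\<^bsub>braid_group n\<^esub> (braid_gen n i [^]\<^bsub>braid_group n\<^esub> (2::nat))
     \<otimes>\<^bsub>braid_group n\<^esub>
     list_mult (braid_group n) (map (\<lambda>m. inv\<^bsub>braid_group n\<^esub> (braid_gen n m)) [i + 1..<j])"

definition pure_j_braids :: "nat \<Rightarrow> nat \<Rightarrow> braid_word set set" where
  "pure_j_braids n j = generate (braid_group n) {pure_gen n i j |i. 1 \<le> i \<and> i < j}"

definition woven_pi :: "nat list \<Rightarrow> braid_word set" where
  "woven_pi ns =
     (let n = sum_list ns in
      list_mult (braid_group n)
        (map (braid_gen n)
          (filter (\<lambda>i. i \<notin> {sum_list (take m ns) |m. 1 \<le> m \<and> m < length ns}) [1..<n])))"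

definition woven_of_type :: "nat list \<Rightarrow> braid_word set set" where
  "woven_of_type ns =
     (let n = sum_list ns in
      {woven_pi ns \<otimes>\<^bsub>braid_group n\<^esub> list_mult (braid_group n) bs |bs.
         length bs = length ns \<and>
         (\<forall>m < length ns. bs ! m \<in> pure_j_braids n (sum_list (take (Suc m) ns)))})"

definition woven_k :: "nat \<Rightarrow> nat \<Rightarrow> braid_word set set" where
  "woven_k n k =
     \<Union> {woven_of_type ns |ns. length ns = k \<and> (\<forall>m \<in> set ns. 0 < m) \<and> sum_list ns = n}"

definition woven :: "nat \<Rightarrow> braid_word set set" where
  "woven n = (\<Union>k\<in>{1..n}. woven_k n k)"

lemma braid_equiv_words: "braid_equiv n u v \<Longrightarrow> u \<in> braid_words n \<and> v \<in> braid_words n"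
  by (induction rule: braid_equiv.induct) (auto simp: braid_words_def)

lemma equiv_braid_rel: "equiv (braid_words n) (braid_rel n)"
  unfolding equiv_def refl_on_def sym_def trans_def braid_rel_def
  using braid_equiv_words braid_equiv.refl braid_equiv.sym braid_equiv.trans by blast

lemma braid_class_mult:
  assumes "u \<in> braid_words n" "v \<in> braid_words n"
  shows "braid_rel n `` {u} \<otimes>\<^bsub>braid_group n\<^esub> braid_rel n `` {v} = braid_rel n `` {u @ v}"
proof -
  have "congruent2 (braid_rel n) (braid_rel n) (\<lambda>u v. braid_rel n `` {u @ v})"
    using equiv_class_eq[OF equiv_braid_rel]
    by (auto simp: congruent2_def braid_rel_def intro: braid_equiv.append)
  from UN_equiv_class2[OF equiv_braid_rel equiv_braid_rel this assms] show ?thesis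
    by (simp add: braid_group_def)
qed

lemma braid_inverse_word:
  "u \<in> braid_words n \<Longrightarrow>
     \<exists>v \<in> braid_words n. braid_equiv n (v @ u) []"
proof (induction u)
  case Nil
  then show ?case using braid_equiv.refl by (auto simp: braid_words_def)
next
  case (Cons a u)
  obtain i b where a: "a = (i, b)" by force
  from Cons.prems have i: "i \<in> {1..<n}" and u: "u \<in> braid_words n"
    by (auto simp: braid_words_def a)
  from Cons.IH[OF u] obtain v where v: "v \<in> braid_words n" "braid_equiv n (v @ u) []" by blast
  have "braid_equiv n [(i, \<not> b), (i, b)] []" using braid_equiv.cancel[OF i, of "\<not> b"] by simp
  from braid_equiv.append[OF this braid_equiv.refl[OF u]]
  have "braid_equiv n ((i, \<not> b) # (i, b) # u) u" by simp
  from braid_equiv.append[OF braid_equiv.refl[OF v(1)] this]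
  have "braid_equiv n ((v @ [(i, \<not> b)]) @ a # u) (v @ u)" by (simp add: a)
  then have "braid_equiv n ((v @ [(i, \<not> b)]) @ a # u) []" using v(2) by (rule braid_equiv.trans)
  moreover have "v @ [(i, \<not> b)] \<in> braid_words n" using v i by (auto simp: braid_words_def)
  ultimately show ?case by blast
qed

lemma group_braid_group: "group (braid_group n)"
proof (rule groupI)
  have Nil: "[] \<in> braid_words n" by (simp add: braid_words_def)
  have app: "u @ v \<in> braid_words n" if "u \<in> braid_words n" "v \<in> braid_words n" for u v
    using that by (auto simp: braid_words_def)
  have one: "\<one>\<^bsub>braid_group n\<^esub> = braid_rel n `` {[]}"
    and car: "carrier (braid_group n) = braid_words n // braid_rel n"
    by (simp_all add: braid_group_def)
  show "\<one>\<^bsub>braid_group n\<^esub> \<in> carrier (braid_group n)"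
    using Nil by (simp add: one car quotientI)
  fix X assume X: "X \<in> carrier (braid_group n)"
  then obtain u where u: "u \<in> braid_words n" "X = braid_rel n `` {u}"
    by (auto simp: car elim: quotientE)
  show "\<one>\<^bsub>braid_group n\<^esub> \<otimes>\<^bsub>braid_group n\<^esub> X = X"
    using braid_class_mult[OF Nil u(1)] u(2) by (simp add: one)
  obtain v where v: "v \<in> braid_words n" "braid_equiv n (v @ u) []"
    using braid_inverse_word[OF u(1)] by blast
  have "braid_rel n `` {v} \<otimes>\<^bsub>braid_group n\<^esub> X = \<one>\<^bsub>braid_group n\<^esub>"
    using braid_class_mult[OF v(1) u(1)] v(2) equiv_class_eq[OF equiv_braid_rel]
    by (simp add: one u(2) braid_rel_def)
  then show "\<exists>Y\<in>carrier (braid_group n). Y \<otimes>\<^bsub>braid_group n\<^esub> X = \<one>\<^bsub>braid_group n\<^esub>"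
    using v(1) by (auto simp: car intro: quotientI)
  fix Y assume Y: "Y \<in> carrier (braid_group n)"
  then obtain v where v: "v \<in> braid_words n" "Y = braid_rel n `` {v}"
    by (auto simp: car elim: quotientE)
  show "X \<otimes>\<^bsub>braid_group n\<^esub> Y \<in> carrier (braid_group n)"
    using braid_class_mult[OF u(1) v(1)] u v app by (auto simp: car intro: quotientI)
  fix Z assume "Z \<in> carrier (braid_group n)"
  then obtain w where w: "w \<in> braid_words n" "Z = braid_rel n `` {w}"
    by (auto simp: car elim: quotientE)
  show "X \<otimes>\<^bsub>braid_group n\<^esub> Y \<otimes>\<^bsub>braid_group n\<^esub> Z = X \<otimes>\<^bsub>braid_group n\<^esub> (Y \<otimes>\<^bsub>braid_group n\<^esub> Z)"
    by (simp add: u v w braid_class_mult app)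
qed

end

theory Submission imports Defs begin

text \<open>
  Modulo the pure braid group the generators become involutions, and in the resulting quotient of
  the symmetric group every element is conjugate to a product \<open>\<pi>\<close> of generators in increasing
  order, some being skipped.  Hence every braid is conjugate to \<open>\<pi> \<beta>\<^sub>1 \<cdots> \<beta>\<^sub>n\<close> with
  \<open>\<beta>\<^sub>j\<close> a pure \<open>j\<close>-braid.  If \<open>\<sigma>\<^sub>j\<close> occurs in \<open>\<pi>\<close>, then conjugation by \<open>\<pi>\<close> sends
  pure \<open>j\<close>-braids to pure \<open>(j + 1)\<close>-braids, so that conjugating the whole braid moves \<open>\<beta>\<^sub>j\<close>
  into \<open>\<beta>\<^bsub>j+1\<^esub>\<close>.  Doing this for increasing \<open>j\<close> leaves only the factors at the ends of the
  blocks of \<open>\<pi>\<close>.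
\<close>

section \<open>Conjugation and products of lists\<close>

text \<open>The braid relations are exploited in an abstract group because the argument visits two
  groups: the braid group and its quotient by the pure braids. Two structural facts carry the proof.
  Braids on fewer than \<open>m\<close> strings normalize the pure \<open>m\<close>-braids; hence a
  pure braid can be combed into factors from \<open>P 1\<close>, ..., \<open>P n\<close>, and an
  element of \<open>P k\<close> arriving at the right end can be pushed left through all factors of
  index above \<open>k\<close>. And the shape of A_ij makes conjugation by the generator of index
  \<open>j\<close> raise the index of a pure \<open>j\<close>-braid by one. Clearing the index
  \<open>j\<close> therefore changes only factors of index above \<open>j\<close>, so what has been
  cleared stays cleared. At a break point the generator that would raise the index is missing from
  \<pi>, and for index \<open>n\<close> there is no such generator; these are exactly the factors
  that a woven braid retains.\<close>

context group
begin

text \<open>Oriented as a left action, in agreement with A_ij, whose generators stand on the left of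
  the square and their inverses on the right.\<close>

definition conj_by :: "'a \<Rightarrow> 'a \<Rightarrow> 'a" where
  "conj_by x y = x \<otimes> y \<otimes> inv x"

lemma conj_by_closed [simp, intro]:
  "x \<in> carrier G \<Longrightarrow> y \<in> carrier G \<Longrightarrow> conj_by x y \<in> carrier G"
  by (simp add: conj_by_def)

lemma conj_by_mult_left:
  "x \<in> carrier G \<Longrightarrow> y \<in> carrier G \<Longrightarrow> z \<in> carrier G \<Longrightarrow>
     conj_by (x \<otimes> y) z = conj_by x (conj_by y z)"
  by (simp add: conj_by_def m_assoc inv_mult_group)

lemma conj_by_one_left [simp]: "y \<in> carrier G \<Longrightarrow> conj_by \<one> y = y"
  by (simp add: conj_by_def)

lemma inv_mult_cancel [simp]:
  "x \<in> carrier G \<Longrightarrow> y \<in> carrier G \<Longrightarrow> inv x \<otimes> (x \<otimes> y) = y"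
  "x \<in> carrier G \<Longrightarrow> y \<in> carrier G \<Longrightarrow> x \<otimes> (inv x \<otimes> y) = y"
  by (simp_all add: m_assoc [symmetric])

lemma conj_by_mult:
  "x \<in> carrier G \<Longrightarrow> y \<in> carrier G \<Longrightarrow> z \<in> carrier G \<Longrightarrow>
     conj_by x (y \<otimes> z) = conj_by x y \<otimes> conj_by x z"
  by (simp add: conj_by_def m_assoc)

lemma conj_by_inv:
  "x \<in> carrier G \<Longrightarrow> y \<in> carrier G \<Longrightarrow> conj_by x (inv y) = inv (conj_by x y)"
  by (simp add: conj_by_def m_assoc inv_mult_group)

lemma conj_by_one [simp]: "x \<in> carrier G \<Longrightarrow> conj_by x \<one> = \<one>"
  by (simp add: conj_by_def)

lemma conj_by_cancel [simp]:
  "x \<in> carrier G \<Longrightarrow> y \<in> carrier G \<Longrightarrow> conj_by (inv x) (conj_by x y) = y"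
  "x \<in> carrier G \<Longrightarrow> y \<in> carrier G \<Longrightarrow> conj_by x (conj_by (inv x) y) = y"
  by (simp_all add: conj_by_mult_left [symmetric])

lemma conj_by_fix_iff:
  "x \<in> carrier G \<Longrightarrow> y \<in> carrier G \<Longrightarrow> conj_by x y = y \<longleftrightarrow> x \<otimes> y = y \<otimes> x"
  by (metis conj_by_def inv_solve_right' m_closed)

lemma conj_by_commute:
  assumes "x \<otimes> y = y \<otimes> x" "x \<in> carrier G" "y \<in> carrier G" "z \<in> carrier G"
  shows "conj_by x (conj_by y z) = conj_by y (conj_by x z)"
  using assms by (metis conj_by_mult_left)

lemma conj_by_generate:
  assumes S: "S \<subseteq> carrier G" and H: "subgroup H G" and x: "x \<in> carrier G"
    and gens: "\<And>a. a \<in> S \<Longrightarrow> conj_by x a \<in> H" and h: "h \<in> generate G S"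
  shows "conj_by x h \<in> H"
  using h
proof (induction rule: generate.induct)
  case one
  then show ?case using x subgroup.one_closed[OF H] by simp
next
  case (incl h)
  then show ?case by (rule gens)
next
  case (inv h)
  then show ?case using gens[OF inv] S x subgroup.m_inv_closed[OF H] by (auto simp: conj_by_inv)
next
  case (eng h1 h2)
  then have "h1 \<in> carrier G" "h2 \<in> carrier G" using generate_in_carrier[OF S] by auto
  then show ?case using eng x subgroup.m_closed[OF H] by (simp add: conj_by_mult)
qed

text \<open>Both \<open>x\<close> and \<open>inv x\<close> have to be tested: in an infinite group,
  conjugation may map a subgroup properly into itself.\<close>

lemma generate_normalizes:
  assumes S: "S \<subseteq> carrier G" and X: "X \<subseteq> carrier G"
    and "\<And>x a. x \<in> X \<Longrightarrow> a \<in> S \<Longrightarrow> conj_by x a \<in> generate G S"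
    and "\<And>x a. x \<in> X \<Longrightarrow> a \<in> S \<Longrightarrow> conj_by (inv x) a \<in> generate G S"
    and g: "g \<in> generate G X" and h: "h \<in> generate G S"
  shows "conj_by g h \<in> generate G S"
proof -
  note H = generate_is_subgroup[OF S]
  have "\<forall>h \<in> generate G S. conj_by g h \<in> generate G S"
    using g
  proof (induction rule: generate.induct)
    case one
    then show ?case using generate_in_carrier[OF S] by simp
  next
    case (incl x)
    then show ?case using assms(3) X conj_by_generate[OF S H] by blast
  next
    case (inv x)
    then have "inv x \<in> carrier G" using X by auto
    then show ?case using inv assms(4) conj_by_generate[OF S H] by blast
  next
    case (eng g1 g2)
    then have "g1 \<in> carrier G" "g2 \<in> carrier G" using generate_in_carrier[OF X] by auto
    then show ?case using eng generate_in_carrier[OF S] by (auto simp: conj_by_mult_left)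
  qed
  then show ?thesis using h by blast
qed

lemma generate_commute:
  assumes X: "X \<subseteq> carrier G" and y: "y \<in> carrier G"
    and gens: "\<And>x. x \<in> X \<Longrightarrow> x \<otimes> y = y \<otimes> x" and g: "g \<in> generate G X"
  shows "g \<otimes> y = y \<otimes> g"
proof -
  have "conj_by y g = g"
    using g
  proof (induction rule: generate.induct)
    case (incl h)
    then show ?case using conj_by_fix_iff gens X y by (metis subsetD)
  next
    case (inv h)
    then show ?case using conj_by_fix_iff gens X y by (metis conj_by_inv subsetD)
  next
    case (eng h1 h2)
    then show ?case using generate_in_carrier[OF X] y by (simp add: conj_by_mult)
  qed (simp add: y)
  then show ?thesis using conj_by_fix_iff generate_in_carrier[OF X g] y by metis
qed

text \<open>As the left subgroup normalizes the right one, the products \<open>x \<otimes> y\<close>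
  are closed under multiplication: \<open>y\<close> moves past the next \<open>x'\<close> and
  becomes \<open>conj_by (inv x') y\<close>.\<close>

lemma generate_Un_factor:
  assumes S: "S \<subseteq> carrier G" and T: "T \<subseteq> carrier G"
    and norm: "\<And>x y. x \<in> generate G S \<Longrightarrow> y \<in> generate G T \<Longrightarrow> conj_by x y \<in> generate G T"
    and g: "g \<in> generate G (S \<union> T)"
  shows "\<exists>x \<in> generate G S. \<exists>y \<in> generate G T. g = x \<otimes> y"
  using g
proof (induction rule: generate.induct)
  case one
  then show ?case using generate.one[of G S] generate.one[of G T] by force
next
  case (incl h)
  then show ?case
  proof
    assume "h \<in> S"
    then show ?case using S generate.one[of G T] by (force intro: generate.incl)
  next
    assume "h \<in> T"
    then show ?case using T generate.one[of G S] by (force intro: generate.incl)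
  qed
next
  case (inv h)
  then show ?case
  proof
    assume "h \<in> S"
    then show ?case using S generate.one[of G T] by (force intro: generate.inv)
  next
    assume "h \<in> T"
    then show ?case using T generate.one[of G S] by (force intro: generate.inv)
  qed
next
  case (eng h1 h2)
  then obtain x y x' y' where xy: "x \<in> generate G S" "y \<in> generate G T" "h1 = x \<otimes> y"
      "x' \<in> generate G S" "y' \<in> generate G T" "h2 = x' \<otimes> y'" by blast
  have cl: "x \<in> carrier G" "x' \<in> carrier G" "y \<in> carrier G" "y' \<in> carrier G"
    using xy generate_in_carrier[OF S] generate_in_carrier[OF T] by auto
  have "inv x' \<in> generate G S" using generate_m_inv_closed[OF S] xy by simp
  then have "conj_by (inv x') y \<otimes> y' \<in> generate G T"
    using norm xy generate.eng by metis
  moreover have "x \<otimes> x' \<in> generate G S" using xy generate.eng by metis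
  moreover have "h1 \<otimes> h2 = (x \<otimes> x') \<otimes> (conj_by (inv x') y \<otimes> y')"
    using xy cl by (simp add: conj_by_def m_assoc)
  ultimately show ?case by blast
qed

lemma list_mult_Nil [simp]: "list_mult G [] = \<one>"
  by (simp add: list_mult_def)

lemma list_mult_Cons [simp]: "list_mult G (x # xs) = x \<otimes> list_mult G xs"
  by (simp add: list_mult_def)

lemma list_mult_closed [simp]: "set xs \<subseteq> carrier G \<Longrightarrow> list_mult G xs \<in> carrier G"
  by (induction xs) auto

lemma list_mult_append:
  "set xs \<subseteq> carrier G \<Longrightarrow> set ys \<subseteq> carrier G \<Longrightarrow>
     list_mult G (xs @ ys) = list_mult G xs \<otimes> list_mult G ys"
  by (induction xs) (auto simp: m_assoc)

lemma list_mult_subgroup: "subgroup H G \<Longrightarrow> set xs \<subseteq> H \<Longrightarrow> list_mult G xs \<in> H"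
  by (induction xs) (auto intro: subgroup.one_closed subgroup.m_closed)

lemma list_mult_filter_one:
  "f ` set xs \<subseteq> carrier G \<Longrightarrow> (\<And>x. x \<in> set xs \<Longrightarrow> \<not> Q x \<Longrightarrow> f x = \<one>) \<Longrightarrow>
     list_mult G (map f (filter Q xs)) = list_mult G (map f xs)"
  by (induction xs) auto

lemma list_mult_commute:
  assumes "y \<in> carrier G" "set xs \<subseteq> carrier G" "\<And>x. x \<in> set xs \<Longrightarrow> x \<otimes> y = y \<otimes> x"
  shows "list_mult G xs \<otimes> y = y \<otimes> list_mult G xs"
  using assms(2,3)
proof (induction xs)
  case (Cons x xs)
  then have "x \<otimes> (list_mult G xs \<otimes> y) = x \<otimes> (y \<otimes> list_mult G xs)" by simp
  also have "\<dots> = y \<otimes> (x \<otimes> list_mult G xs)"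
    using Cons.prems assms(1) by (simp add: m_assoc [symmetric])
  finally show ?case using Cons.prems assms(1) by (simp add: m_assoc)
qed (use assms in simp)

end

section \<open>Pure braid generators\<close>

text \<open>Only the relations are assumed, so that the locale applies to the braid group as well as
  to its quotient by the pure braids.\<close>

locale braid_gens = group G for G (structure) +
  fixes n :: nat and s :: "nat \<Rightarrow> 'a"
  assumes s_closed [simp]: "1 \<le> i \<Longrightarrow> i < n \<Longrightarrow> s i \<in> carrier G"
    and s_commute: "1 \<le> i \<Longrightarrow> i + 2 \<le> j \<Longrightarrow> j < n \<Longrightarrow> s i \<otimes> s j = s j \<otimes> s i"
    and s_braid: "1 \<le> i \<Longrightarrow> Suc i < n \<Longrightarrow>
      s i \<otimes> s (Suc i) \<otimes> s i = s (Suc i) \<otimes> s i \<otimes> s (Suc i)"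
begin

lemma s_braid':
  assumes "1 \<le> i" "Suc i < n" "z \<in> carrier G"
  shows "s i \<otimes> (s (Suc i) \<otimes> (s i \<otimes> z)) = s (Suc i) \<otimes> (s i \<otimes> (s (Suc i) \<otimes> z))"
  using s_braid[of i] assms by (metis Suc_lessD le_Suc_eq m_assoc m_closed s_closed)

text \<open>The subgroup of the first \<open>m\<close> strings: \<open>s i\<close> involves the
  strings \<open>i\<close> and \<open>i + 1\<close>, so the indices stop below
  \<open>m\<close>.\<close>

definition B :: "nat \<Rightarrow> 'a set" where
  "B m = generate G (s ` {1..<m})"

lemma s_image: "m \<le> n \<Longrightarrow> s ` {1..<m} \<subseteq> carrier G"
  by auto

lemma B_subgroup: "m \<le> n \<Longrightarrow> subgroup (B m) G"
  unfolding B_def by (rule generate_is_subgroup) (rule s_image)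

lemma B_closed: "m \<le> n \<Longrightarrow> x \<in> B m \<Longrightarrow> x \<in> carrier G"
  using B_subgroup subgroup.mem_carrier by metis

lemma B_mono: "k \<le> m \<Longrightarrow> B k \<subseteq> B m"
  unfolding B_def by (rule mono_generate) auto

lemma s_in_B: "1 \<le> i \<Longrightarrow> i < m \<Longrightarrow> s i \<in> B m"
  unfolding B_def by (rule generate.incl) auto

lemma B_commute: "k < j \<Longrightarrow> j < n \<Longrightarrow> x \<in> B k \<Longrightarrow> x \<otimes> s j = s j \<otimes> x"
  unfolding B_def by (rule generate_commute[where X = "s ` {1..<k}"]) (auto intro!: s_commute)

text \<open>The recursion peels off the outermost conjugator of A_ij. Only the values with
  \<open>1 \<le> i\<close> and \<open>i < j\<close> are meaningful.\<close>

fun A :: "nat \<Rightarrow> nat \<Rightarrow> 'a" where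
  "A i 0 = \<one>"
| "A i (Suc j) = (if i = j then s j \<otimes> s j else conj_by (s j) (A i j))"

lemma A_in_B: "1 \<le> i \<Longrightarrow> i < j \<Longrightarrow> j \<le> n \<Longrightarrow> A i j \<in> B j"
proof (induction j)
  case (Suc j)
  note H = B_subgroup[OF Suc.prems(3)]
  have sj: "s j \<in> B (Suc j)" using Suc.prems by (intro s_in_B) auto
  show ?case
  proof (cases "i = j")
    case False
    then have "A i j \<in> B (Suc j)" using Suc B_mono[of j "Suc j"] by auto
    then show ?thesis
      using False sj by (simp add: conj_by_def subgroup.m_closed[OF H] subgroup.m_inv_closed[OF H])
  qed (use sj in \<open>simp add: subgroup.m_closed[OF H]\<close>)
qed simp

lemma A_closed [simp]: "1 \<le> i \<Longrightarrow> i < j \<Longrightarrow> j \<le> n \<Longrightarrow> A i j \<in> carrier G"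
  using A_in_B B_closed by blast

lemma A_fix_high:
  assumes "1 \<le> i" "i < m" "m < k" "k < n"
  shows "conj_by (s k) (A i m) = A i m"
proof -
  have "A i m \<otimes> s k = s k \<otimes> A i m" using assms A_in_B[of i m] by (intro B_commute[of m]) auto
  then show ?thesis using assms by (simp add: conj_by_fix_iff)
qed

text \<open>The \<open>m\<close>-th string passes the strings \<open>i\<close> and
  \<open>i + 1\<close> together, so their crossing slides past it. Algebraically this is the braid
  relation at \<open>m = i + 2\<close>, where the surplus \<open>s (Suc i)\<close> is absorbed by
  \<open>A j i\<close>; for larger \<open>m\<close> the new conjugator commutes with
  \<open>s i\<close>.\<close>

lemma A_fix_middle:
  assumes "1 \<le> j" "j < i" "Suc i < m" "m \<le> n"
  shows "conj_by (s i) (A j m) = A j m"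
  using assms(3,4)
proof (induction m)
  case (Suc m)
  show ?case
  proof (cases "m = Suc i")
    case True
    let ?a = "s i" and ?b = "s (Suc i)"
    have cl: "?a \<in> carrier G" "?b \<in> carrier G" "A j i \<in> carrier G"
      using assms Suc.prems True by auto
    have "conj_by ?a (conj_by ?b (conj_by ?a (A j i))) = conj_by (?a \<otimes> ?b \<otimes> ?a) (A j i)"
      using cl by (simp add: conj_by_mult_left)
    also have "\<dots> = conj_by (?b \<otimes> ?a \<otimes> ?b) (A j i)"
      using assms Suc.prems True by (subst s_braid) auto
    also have "\<dots> = conj_by ?b (conj_by ?a (conj_by ?b (A j i)))"
      using cl by (simp add: conj_by_mult_left)
    also have "conj_by ?b (A j i) = A j i" using assms Suc.prems True by (intro A_fix_high) auto
    finally show ?thesis using True assms by simp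
  next
    case False
    have "conj_by (s i) (conj_by (s m) (A j m)) = conj_by (s m) (conj_by (s i) (A j m))"
      using assms Suc.prems False by (intro conj_by_commute s_commute) auto
    then show ?thesis using Suc assms False by simp
  qed
qed simp

lemma A_fix_low:
  assumes "1 \<le> i" "Suc i < j" "j < m" "m \<le> n"
  shows "conj_by (s i) (A j m) = A j m"
  using assms(3,4)
proof (induction m)
  case (Suc m)
  have comm: "s i \<otimes> s m = s m \<otimes> s i" using assms Suc.prems by (intro s_commute) auto
  show ?case
  proof (cases "j = m")
    case True
    have "conj_by (s i) (s m) = s m" using assms comm Suc.prems by (simp add: conj_by_fix_iff)
    then show ?thesis using assms True Suc.prems by (simp add: conj_by_mult)
  next
    case False
    have "conj_by (s i) (conj_by (s m) (A j m)) = conj_by (s m) (conj_by (s i) (A j m))"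
      using assms Suc.prems False by (intro conj_by_commute comm) auto
    then show ?thesis using Suc assms False by simp
  qed
qed simp

text \<open>These are Artin's formulas for the action of a braid generator: the two elements are
  exchanged up to conjugation, and the product \<open>A j m \<otimes> A (Suc j) m\<close> is
  preserved. The braid relation enters only at \<open>m = j + 2\<close>; all further conjugators
  commute with \<open>s j\<close>.\<close>

lemma A_step_up:
  assumes "1 \<le> j" "Suc j < m" "m \<le> n"
  shows "conj_by (s j) (A j m) = A (Suc j) m \<and>
    conj_by (s j) (A (Suc j) m) = inv (A (Suc j) m) \<otimes> A j m \<otimes> A (Suc j) m"
  using assms(2,3)
proof (induction m)
  case (Suc m)
  show ?case
  proof (cases "m = Suc j")
    case True
    let ?a = "s j" and ?b = "s (Suc j)"
    have cl: "?a \<in> carrier G" "?b \<in> carrier G" using assms Suc.prems True by auto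
    have br: "?a \<otimes> (?b \<otimes> (?a \<otimes> z)) = ?b \<otimes> (?a \<otimes> (?b \<otimes> z))" if "z \<in> carrier G" for z
      using s_braid'[of j z] that assms Suc.prems True by auto
    have br1: "?a \<otimes> (?b \<otimes> ?a) = ?b \<otimes> (?a \<otimes> ?b)" using br[of \<one>] cl by simp
    have "conj_by ?a (conj_by ?b (?a \<otimes> ?a)) = ?b \<otimes> ?b"
    proof -
      have "?a \<otimes> (?b \<otimes> (?a \<otimes> ?a)) = ?b \<otimes> (?b \<otimes> (?a \<otimes> ?b))"
        using br br1 cl by simp
      then have "?a \<otimes> (?b \<otimes> (?a \<otimes> (?a \<otimes> (inv ?b \<otimes> inv ?a)))) =
          ?b \<otimes> (?b \<otimes> (?a \<otimes> ?b)) \<otimes> (inv ?b \<otimes> inv ?a)"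
        using cl by (metis inv_closed m_assoc m_closed)
      then show ?thesis using cl by (simp add: conj_by_def m_assoc)
    qed
    moreover have "conj_by ?a (?b \<otimes> ?b) =
        inv (?b \<otimes> ?b) \<otimes> conj_by ?b (?a \<otimes> ?a) \<otimes> (?b \<otimes> ?b)"
    proof -
      \<comment> \<open>After cancellation the claim says that conjugating the square of
        \<open>?b\<close> by \<open>?a\<close> equals conjugating the square of \<open>?a\<close> by
        \<open>inv ?b\<close>; this is the same identity with the inverses cleared.\<close>
      have "?b \<otimes> (?a \<otimes> (?b \<otimes> ?b)) = ?a \<otimes> (?a \<otimes> (?b \<otimes> ?a))"
        using br[of ?b] br1 cl by simp
      then have "inv ?b \<otimes> (?b \<otimes> (?a \<otimes> (?b \<otimes> ?b))) \<otimes> inv ?a =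
          inv ?b \<otimes> (?a \<otimes> (?a \<otimes> (?b \<otimes> ?a))) \<otimes> inv ?a" by simp
      then show ?thesis using cl by (simp add: conj_by_def m_assoc inv_mult_group)
    qed
    ultimately show ?thesis using True by simp
  next
    case False
    have m: "Suc j < m" "m \<le> n" using Suc.prems False by auto
    have cl: "A j m \<in> carrier G" "A (Suc j) m \<in> carrier G" "s m \<in> carrier G" "s j \<in> carrier G"
      using assms m Suc.prems by auto
    have "conj_by (s j) (conj_by (s m) z) = conj_by (s m) (conj_by (s j) z)"
      if "z \<in> carrier G" for z
      using assms Suc.prems False that by (intro conj_by_commute s_commute) auto
    then show ?thesis using Suc.IH[OF m] cl m by (simp add: conj_by_mult conj_by_inv)
  qed
qed simp

definition P :: "nat \<Rightarrow> 'a set" where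
  "P j = generate G {A i j |i. 1 \<le> i \<and> i < j}"

lemma A_image: "j \<le> n \<Longrightarrow> {A i j |i. 1 \<le> i \<and> i < j} \<subseteq> carrier G"
  by auto

lemma P_subgroup: "j \<le> n \<Longrightarrow> subgroup (P j) G"
  unfolding P_def by (rule generate_is_subgroup) (rule A_image)

lemma A_in_P: "1 \<le> i \<Longrightarrow> i < j \<Longrightarrow> A i j \<in> P j"
  unfolding P_def by (rule generate.incl) auto

lemma P_subset_B: "j \<le> n \<Longrightarrow> P j \<subseteq> B j"
  unfolding P_def by (rule generate_subgroup_incl) (auto intro: A_in_B B_subgroup)

lemma P_closed: "j \<le> n \<Longrightarrow> x \<in> P j \<Longrightarrow> x \<in> carrier G"
  using P_subgroup subgroup.mem_carrier by metis

lemma conj_by_s_A: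
  assumes "1 \<le> i" "Suc i < m" "m \<le> n" "1 \<le> j" "j < m"
  shows "conj_by (s i) (A j m) \<in> P m" and "conj_by (inv (s i)) (A j m) \<in> P m"
proof -
  note H = P_subgroup[OF assms(3)]
  have si: "s i \<in> carrier G" using assms by auto
  have fixed: "conj_by (s i) (A j m) \<in> P m \<and> conj_by (inv (s i)) (A j m) \<in> P m"
    if "conj_by (s i) (A j m) = A j m"
  proof -
    have "conj_by (inv (s i)) (A j m) = A j m"
      using conj_by_cancel(1)[OF si, of "A j m"] that assms by simp
    with that show ?thesis using A_in_P assms by auto
  qed
  let ?u = "A i m" and ?v = "A (Suc i) m"
  have uv: "?u \<in> P m" "?v \<in> P m" using assms by (auto intro: A_in_P)
  then have cl: "?u \<in> carrier G" "?v \<in> carrier G" using P_closed assms by auto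
  have up: "conj_by (s i) ?u = ?v" "conj_by (s i) ?v = inv ?v \<otimes> ?u \<otimes> ?v"
    using A_step_up[of i m] assms by auto
  \<comment> \<open>The preimage of \<open>?u\<close> comes from solving Artin's formulas:
    \<open>?v\<close> maps to \<open>inv ?v \<otimes> ?u \<otimes> ?v\<close>, and conjugating
    \<open>?v\<close> by \<open>?u\<close>, which maps to \<open>?v\<close>, undoes the outer
    factors.\<close>
  have "conj_by (s i) (?u \<otimes> ?v \<otimes> inv ?u) = ?u"
    using cl si up by (simp add: conj_by_mult conj_by_inv m_assoc)
  then have down: "conj_by (inv (s i)) ?u = ?u \<otimes> ?v \<otimes> inv ?u"
    using conj_by_cancel(1)[OF si] cl by (metis inv_closed m_closed)
  have down': "conj_by (inv (s i)) ?v = ?u"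
    using conj_by_cancel(1)[OF si cl(1)] up by simp
  consider "j < i" | "j = i" | "j = Suc i" | "Suc i < j" by linarith
  then have "conj_by (s i) (A j m) \<in> P m \<and> conj_by (inv (s i)) (A j m) \<in> P m"
  proof cases
    case 1
    then show ?thesis using fixed A_fix_middle[of j i m] assms by auto
  next
    case 2
    then show ?thesis
      using up down uv subgroup.m_closed[OF H] subgroup.m_inv_closed[OF H] by simp
  next
    case 3
    then show ?thesis
      using up down' uv subgroup.m_closed[OF H] subgroup.m_inv_closed[OF H] by simp
  next
    case 4
    then show ?thesis using fixed A_fix_low[of i j m] assms by auto
  qed
  then show "conj_by (s i) (A j m) \<in> P m" "conj_by (inv (s i)) (A j m) \<in> P m" by auto
qed

text \<open>The strict bound \<open>j < m\<close> keeps out \<open>s (m - 1)\<close>, the generator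
  that carries \<open>A i (m - 1)\<close> to \<open>A i m\<close>. The remaining generators act by
  Artin's formulas.\<close>

lemma B_normalizes_P:
  assumes "j < m" "m \<le> n" "x \<in> B j" "y \<in> P m"
  shows "conj_by x y \<in> P m"
  unfolding P_def
proof (rule generate_normalizes[OF A_image s_image _ _ assms(3)[unfolded B_def] assms(4)[unfolded P_def]])
  fix x a assume "x \<in> s ` {1..<j}" "a \<in> {A i m |i. 1 \<le> i \<and> i < m}"
  then obtain i k where "x = s i" "1 \<le> i" "i < j" "a = A k m" "1 \<le> k" "k < m" by auto
  then show "conj_by x a \<in> generate G {A i m |i. 1 \<le> i \<and> i < m}"
      "conj_by (inv x) a \<in> generate G {A i m |i. 1 \<le> i \<and> i < m}"
    using conj_by_s_A[of i m k] assms by (auto simp: P_def)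
qed (use assms in auto)

lemma conj_by_s_P:
  assumes "1 \<le> j" "j < n" "x \<in> P j"
  shows "conj_by (s j) x \<in> P (Suc j)"
proof (rule conj_by_generate)
  fix a assume "a \<in> {A i j |i. 1 \<le> i \<and> i < j}"
  then obtain i where i: "a = A i j" "1 \<le> i" "i < j" by auto
  then have "conj_by (s j) a = A i (Suc j)" by simp
  then show "conj_by (s j) a \<in> P (Suc j)" using i A_in_P[of i "Suc j"] by auto
qed (use assms P_subgroup[of "Suc j"] in \<open>auto simp: P_def\<close>)

section \<open>The pure braid group\<close>

definition PB :: "nat \<Rightarrow> 'a set" where
  "PB k = generate G {A i j |i j. 1 \<le> i \<and> i < j \<and> j \<le> k}"

lemma PB_gens: "k \<le> n \<Longrightarrow> {A i j |i j. 1 \<le> i \<and> i < j \<and> j \<le> k} \<subseteq> carrier G"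
  by auto

lemma PB_subgroup: "k \<le> n \<Longrightarrow> subgroup (PB k) G"
  unfolding PB_def by (rule generate_is_subgroup) (rule PB_gens)

lemma A_in_PB: "1 \<le> i \<Longrightarrow> i < j \<Longrightarrow> j \<le> k \<Longrightarrow> A i j \<in> PB k"
  unfolding PB_def by (rule generate.incl) auto

lemma P_subset_PB: "j \<le> k \<Longrightarrow> P j \<subseteq> PB k"
  unfolding P_def PB_def by (rule mono_generate) auto

lemma PB_subset_B:
  assumes "k \<le> n" shows "PB k \<subseteq> B k"
proof -
  have "A i j \<in> B k" if "1 \<le> i" "i < j" "j \<le> k" for i j
    using A_in_B[of i j] B_mono[of j k] that assms by auto
  then show ?thesis
    unfolding PB_def by (intro generate_subgroup_incl) (auto intro: B_subgroup assms)
qed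

text \<open>The delicate case is the pair \<open>A i k\<close>, \<open>A i (Suc k)\<close>. One is
  carried to the other by \<open>s k\<close> by definition; in the opposite direction the
  discrepancy is a conjugation by the square of \<open>s k\<close>, which is the pure braid
  \<open>A k (Suc k)\<close>.\<close>

lemma conj_by_s_A_PB:
  assumes "1 \<le> k" "k < n" "1 \<le> i" "i < j" "j \<le> n"
  shows "conj_by (s k) (A i j) \<in> PB n \<and> conj_by (inv (s k)) (A i j) \<in> PB n"
proof -
  note H = PB_subgroup[OF order_refl]
  have cl: "s k \<in> carrier G" "A i j \<in> carrier G" using assms by auto
  have sq: "s k \<otimes> s k \<in> PB n" using A_in_PB[of k "Suc k" n] assms by simp
  have conj_sq: "conj_by (s k \<otimes> s k) x \<in> PB n" "conj_by (inv (s k \<otimes> s k)) x \<in> PB n"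
    if "x \<in> PB n" for x
    using that sq unfolding conj_by_def
    by (simp_all add: subgroup.m_closed[OF H] subgroup.m_inv_closed[OF H])
  have A: "A i j \<in> PB n" using A_in_PB assms by auto
  have fixed: ?thesis if "conj_by (s k) (A i j) = A i j"
  proof -
    have "conj_by (inv (s k)) (A i j) = A i j"
      using conj_by_cancel(1)[OF cl] that by simp
    with that show ?thesis using A by auto
  qed
  consider "j < k" | "j = k" | "j = Suc k" "i = k" | "j = Suc k" "i < k" | "Suc k < j"
    using assms by linarith
  then show ?thesis
  proof cases
    case 1
    then show ?thesis using fixed A_fix_high assms by auto
  next
    case 2
    then have up: "conj_by (s k) (A i j) = A i (Suc k)" using assms by simp
    then have "conj_by (s k) (A i j) \<in> PB n" using A_in_PB[of i "Suc k" n] assms 2 by simp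
    moreover have "conj_by (inv (s k)) (A i j) = conj_by (inv (s k \<otimes> s k)) (A i (Suc k))"
      unfolding up[symmetric] using cl by (simp add: inv_mult_group conj_by_mult_left del: A.simps)
    ultimately show ?thesis using conj_sq A_in_PB[of i "Suc k" n] assms 2 by auto
  next
    case 3
    then have "A i j = s k \<otimes> s k" by simp
    then have "conj_by (s k) (A i j) = A i j" using cl by (simp add: conj_by_fix_iff m_assoc)
    then show ?thesis by (rule fixed)
  next
    case 4
    then have Aj: "A i j = conj_by (s k) (A i k)" by simp
    have Ak: "A i k \<in> PB n" using A_in_PB assms 4 by auto
    then have "A i k \<in> carrier G" using subgroup.mem_carrier[OF H] by auto
    then have "conj_by (s k) (A i j) = conj_by (s k \<otimes> s k) (A i k)"
        "conj_by (inv (s k)) (A i j) = A i k"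
      using cl(1) by (simp_all add: Aj conj_by_mult_left)
    then show ?thesis using conj_sq Ak by simp
  next
    case 5
    then show ?thesis using conj_by_s_A[of k j i] P_subset_PB[of j n] assms by auto
  qed
qed

lemma PB_normal:
  assumes "carrier G = B n"
  shows "PB n \<lhd> G"
proof -
  have "conj_by x y \<in> PB n" if "x \<in> B n" "y \<in> PB n" for x y
    using that(1)[unfolded B_def] that(2)[unfolded PB_def] unfolding PB_def
  proof (rule generate_normalizes[OF PB_gens s_image, rotated 4])
    fix x a assume "x \<in> s ` {1..<n}" "a \<in> {A i j |i j. 1 \<le> i \<and> i < j \<and> j \<le> n}"
    then obtain k i j where "x = s k" "1 \<le> k" "k < n" "a = A i j" "1 \<le> i" "i < j" "j \<le> n" by auto
    then show "conj_by x a \<in> generate G {A i j |i j. 1 \<le> i \<and> i < j \<and> j \<le> n}"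
        "conj_by (inv x) a \<in> generate G {A i j |i j. 1 \<le> i \<and> i < j \<and> j \<le> n}"
      using conj_by_s_A_PB[of k i j] by (auto simp: PB_def)
  qed auto
  then show ?thesis
    using assms PB_subgroup by (simp add: normal_inv_iff conj_by_def)
qed

section \<open>Combing of pure braids\<close>

definition comb :: "(nat \<Rightarrow> 'a) \<Rightarrow> nat \<Rightarrow> 'a" where
  "comb p m = list_mult G (map p [1..<Suc m])"

lemma comb_0 [simp]: "comb p 0 = \<one>"
  by (simp add: comb_def)

lemma comb_Suc:
  assumes "\<And>i. 1 \<le> i \<Longrightarrow> i \<le> Suc m \<Longrightarrow> p i \<in> carrier G"
  shows "comb p (Suc m) = comb p m \<otimes> p (Suc m)"
proof -
  have "[1..<Suc (Suc m)] = [1..<Suc m] @ [Suc m]" by simp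
  moreover have "p ` {1..<Suc m} \<subseteq> carrier G" "p (Suc m) \<in> carrier G" using assms by auto
  ultimately show ?thesis unfolding comb_def by (simp add: list_mult_append del: upt_Suc)
qed

lemma comb_cong: "(\<And>i. 1 \<le> i \<Longrightarrow> i \<le> m \<Longrightarrow> p i = q i) \<Longrightarrow> comb p m = comb q m"
  unfolding comb_def by (intro arg_cong[where f = "list_mult G"] map_cong) auto

lemma comb_in_B:
  assumes "m \<le> n" "\<And>i. 1 \<le> i \<Longrightarrow> i \<le> m \<Longrightarrow> p i \<in> P i"
  shows "comb p m \<in> B m"
proof -
  have "p i \<in> B m" if "1 \<le> i" "i \<le> m" for i
    using assms that P_subset_B[of i] B_mono[of i m] by force
  then show ?thesis unfolding comb_def by (intro list_mult_subgroup B_subgroup assms) auto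
qed

text \<open>The generators of \<open>PB (Suc k)\<close> are those of \<open>PB k\<close> together
  with those of \<open>P (Suc k)\<close>. Since \<open>PB k\<close> lies in \<open>B k\<close>, it
  normalizes \<open>P (Suc k)\<close>, so one factor splits off on the right.\<close>

lemma PB_comb:
  "k \<le> n \<Longrightarrow> x \<in> PB k \<Longrightarrow> \<exists>p. (\<forall>i. 1 \<le> i \<longrightarrow> i \<le> k \<longrightarrow> p i \<in> P i) \<and> x = comb p k"
proof (induction k arbitrary: x)
  case 0
  have "{A i j |i j. 1 \<le> i \<and> i < j \<and> j \<le> 0} = {}" by auto
  then show ?case using 0 by (simp add: PB_def generate_empty)
next
  case (Suc k)
  have "{A i j |i j. 1 \<le> i \<and> i < j \<and> j \<le> Suc k} =
      {A i j |i j. 1 \<le> i \<and> i < j \<and> j \<le> k} \<union> {A i (Suc k) |i. 1 \<le> i \<and> i < Suc k}"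
    by (auto simp: le_Suc_eq simp del: A.simps)
  then have "x \<in> generate G \<dots>" using Suc.prems by (simp add: PB_def)
  then have "\<exists>y \<in> PB k. \<exists>z \<in> P (Suc k). x = y \<otimes> z"
    unfolding PB_def P_def
  proof (rule generate_Un_factor[rotated 3])
    fix y z assume "y \<in> generate G {A i j |i j. 1 \<le> i \<and> i < j \<and> j \<le> k}"
      and "z \<in> generate G {A i (Suc k) |i. 1 \<le> i \<and> i < Suc k}"
    then have "y \<in> B k" "z \<in> P (Suc k)"
      using PB_subset_B[of k] Suc.prems unfolding PB_def P_def by auto
    then show "conj_by y z \<in> generate G {A i (Suc k) |i. 1 \<le> i \<and> i < Suc k}"
      using B_normalizes_P[of k "Suc k" y z] Suc.prems unfolding P_def by simp
  qed (use Suc.prems in auto)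
  then obtain y z where yz: "y \<in> PB k" "z \<in> P (Suc k)" "x = y \<otimes> z" by blast
  then obtain p where p: "\<forall>i. 1 \<le> i \<longrightarrow> i \<le> k \<longrightarrow> p i \<in> P i" "y = comb p k"
    using Suc by auto
  let ?p = "p(Suc k := z)"
  have P: "\<forall>i. 1 \<le> i \<longrightarrow> i \<le> Suc k \<longrightarrow> ?p i \<in> P i" using p yz by auto
  have "?p i \<in> carrier G" if "1 \<le> i" "i \<le> Suc k" for i
    using P P_closed[of i] that Suc.prems by (metis order_trans)
  then have "comb ?p (Suc k) = comb ?p k \<otimes> z" by (subst comb_Suc) auto
  moreover have "comb ?p k = comb p k" by (rule comb_cong) auto
  ultimately show ?case using P p yz by metis
qed

section \<open>Removing superfluous factors\<close>

text \<open>\<open>S\<close> holds the break points between blocks. It may be any set of numbers: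
  only its members from \<open>1\<close> to \<open>m - 1\<close> have an effect.\<close>

definition pi_skip :: "nat set \<Rightarrow> nat \<Rightarrow> 'a" where
  "pi_skip S m = list_mult G (map s (filter (\<lambda>i. i \<notin> S) [1..<m]))"

lemma pi_skip_in_B: "m \<le> n \<Longrightarrow> pi_skip S m \<in> B m"
  unfolding pi_skip_def by (rule list_mult_subgroup[OF B_subgroup]) (auto intro: s_in_B)

lemma upt_split: "1 \<le> m \<Longrightarrow> m < l \<Longrightarrow> [1..<l] = [1..<m] @ m # [Suc m..<l]"
  using upt_add_eq_append[of 1 m "l - m"] by (simp add: upt_rec[of m])

text \<open>Split the product at \<open>s j\<close>. The generators to its right commute with
  \<open>B j\<close>, \<open>s j\<close> itself raises the index by one, and those to its left lie
  in \<open>B j\<close>, which normalizes \<open>P (Suc j)\<close>.\<close>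

lemma conj_by_pi_skip_P:
  assumes "1 \<le> j" "j < n" "j \<notin> S" "x \<in> P j"
  shows "conj_by (pi_skip S n) x \<in> P (Suc j)"
proof -
  let ?hi = "list_mult G (map s (filter (\<lambda>i. i \<notin> S) [Suc j..<n]))"
  have hi: "?hi \<in> carrier G" by (rule list_mult_closed) (use assms in auto)
  have x: "x \<in> carrier G" "x \<in> B j" using assms P_closed[of j] P_subset_B[of j] by auto
  have lo: "pi_skip S j \<in> B j" "pi_skip S j \<in> carrier G"
    using pi_skip_in_B[of j S] B_closed[of j] assms by auto
  have "pi_skip S n = list_mult G (map s (filter (\<lambda>i. i \<notin> S) [1..<j]) @ s j #
      map s (filter (\<lambda>i. i \<notin> S) [Suc j..<n]))"
    using assms upt_split[of j n] by (simp add: pi_skip_def)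
  also have "\<dots> = pi_skip S j \<otimes> (s j \<otimes> ?hi)"
    unfolding pi_skip_def by (subst list_mult_append) (use assms in auto)
  finally have "conj_by (pi_skip S n) x = conj_by (pi_skip S j) (conj_by (s j) (conj_by ?hi x))"
    using assms hi lo x by (simp add: conj_by_mult_left)
  also have "conj_by ?hi x = x"
  proof -
    have "?hi \<otimes> x = x \<otimes> ?hi"
      by (rule list_mult_commute) (use assms x B_commute[of j _ x] in auto)
    then show ?thesis using conj_by_fix_iff hi x by simp
  qed
  finally show ?thesis
    using B_normalizes_P[of j "Suc j"] lo conj_by_s_P assms by auto
qed

text \<open>Pushing \<open>\<delta>\<close> left past a factor of index \<open>i > k\<close>
  conjugates that factor by \<open>inv \<delta>\<close>, which stays in \<open>P i\<close> because
  \<open>\<delta>\<close> lies in \<open>B k\<close>. At index \<open>k\<close> it is multiplied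
  into the factor, and smaller indices are never reached.\<close>

lemma comb_absorb:
  assumes "1 \<le> k" "k \<le> m" "m \<le> n" "\<delta> \<in> P k" "\<And>i. 1 \<le> i \<Longrightarrow> i \<le> n \<Longrightarrow> p i \<in> P i"
  shows "\<exists>q. (\<forall>i. 1 \<le> i \<longrightarrow> i \<le> n \<longrightarrow> q i \<in> P i) \<and> (\<forall>i<k. q i = p i) \<and>
    comb p m \<otimes> \<delta> = comb q m"
proof -
  define q where "q = (\<lambda>i. if i < k then p i else if i = k then p i \<otimes> \<delta> else conj_by (inv \<delta>) (p i))"
  have \<delta>B: "inv \<delta> \<in> B k" and \<delta>: "\<delta> \<in> carrier G"
    using assms P_subset_B[of k] B_subgroup[of k] P_closed[of k] by (auto intro: subgroup.m_inv_closed)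
  have q: "q i \<in> P i" if "1 \<le> i" "i \<le> n" for i
  proof -
    have "p k \<otimes> \<delta> \<in> P k" using subgroup.m_closed[OF P_subgroup] assms by auto
    moreover have "conj_by (inv \<delta>) (p i) \<in> P i" if "k < i"
      using B_normalizes_P[of k i] \<delta>B assms(5) that \<open>1 \<le> i\<close> \<open>i \<le> n\<close> by auto
    ultimately show ?thesis using that assms by (auto simp: q_def)
  qed
  have cl: "p i \<in> carrier G" "q i \<in> carrier G" if "1 \<le> i" "i \<le> n" for i
    using that assms(5) q P_closed by blast+
  have "comb p m \<otimes> \<delta> = comb q m"
    using assms(2,3)
  proof (induction m rule: dec_induct)
    case base
    obtain k' where k': "k = Suc k'" using assms(1) by (cases k) auto
    have "comb q k' = comb p k'" by (rule comb_cong) (auto simp: k' q_def)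
    moreover have "comb p k' \<in> carrier G"
      using comb_in_B[of k' p] B_closed[of k'] assms k' by auto
    moreover have "comb q k = comb q k' \<otimes> q k"
      unfolding k' by (rule comb_Suc) (use cl(2) base in \<open>auto simp: k'\<close>)
    moreover have "comb p k = comb p k' \<otimes> p k"
      unfolding k' by (rule comb_Suc) (use cl(1) base in \<open>auto simp: k'\<close>)
    ultimately show ?case using cl[of k] assms \<delta> base by (simp add: m_assoc q_def)
  next
    case (step m)
    have pc: "comb p m \<in> carrier G" using comb_in_B[of m p] B_closed[of m] assms step by auto
    have "comb p (Suc m) = comb p m \<otimes> p (Suc m)" by (rule comb_Suc) (use cl(1) step in auto)
    moreover have "p (Suc m) \<in> carrier G" using cl(1) step by auto
    ultimately have "comb p (Suc m) \<otimes> \<delta> = comb p m \<otimes> \<delta> \<otimes> conj_by (inv \<delta>) (p (Suc m))"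
      using pc \<delta> by (simp add: conj_by_def m_assoc)
    also have "\<dots> = comb q m \<otimes> q (Suc m)" using step by (simp add: q_def)
    also have "\<dots> = comb q (Suc m)"
      by (rule comb_Suc[symmetric]) (use cl(2) step in auto)
    finally show ?case .
  qed
  then show ?thesis using q by (intro exI[of _ q]) (auto simp: q_def)
qed

text \<open>
  Moving the factor at \<open>j\<close> to the left end turns it into an element of \<open>P (Suc j)\<close>; conjugating
  by that element carries it around to the right end, where it merges into the factor at
  \<open>Suc j\<close> without touching the factors before it.
\<close>

lemma sweep_step:
  assumes "1 \<le> j" "j < n" "j \<notin> S" and p: "\<And>i. 1 \<le> i \<Longrightarrow> i \<le> n \<Longrightarrow> p i \<in> P i"
  shows "\<exists>\<delta> \<in> carrier G. \<exists>q. (\<forall>i. 1 \<le> i \<longrightarrow> i \<le> n \<longrightarrow> q i \<in> P i) \<and>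
    (\<forall>i<j. q i = p i) \<and> q j = \<one> \<and>
    conj_by \<delta> (pi_skip S n \<otimes> comb p n) = pi_skip S n \<otimes> comb q n"
proof -
  let ?\<pi> = "pi_skip S n"
  define p' where "p' = p(j := \<one>)"
  obtain j' where j': "j = Suc j'" using assms(1) by (cases j) auto
  have cl: "p i \<in> carrier G" if "1 \<le> i" "i \<le> n" for i
    using that p P_closed by blast
  have \<pi>: "?\<pi> \<in> carrier G" using pi_skip_in_B B_closed by blast
  have p'P: "p' i \<in> P i" if "1 \<le> i" "i \<le> n" for i
    using that p subgroup.one_closed[OF P_subgroup] by (auto simp: p'_def)
  then have cl': "p' i \<in> carrier G" if "1 \<le> i" "i \<le> n" for i
    using that P_closed by blast
  have EB: "comb p j' \<in> B j'" using comb_in_B[of j' p] assms j' by auto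
  then have E: "comb p j' \<in> carrier G" using B_closed[of j'] assms j' by auto
  \<comment> \<open>Chosen so that taking the factor \<open>p j\<close> out to the left, across
    \<open>comb p j'\<close> and \<open>?\<pi>\<close>, turns it into \<open>\<delta>\<close>. The
    inner conjugator is in \<open>B j'\<close>, hence keeps it in \<open>P j\<close>; the outer one
    raises the index.\<close>
  define \<delta> where "\<delta> = conj_by ?\<pi> (conj_by (comb p j') (p j))"
  have \<delta>P: "\<delta> \<in> P (Suc j)"
    unfolding \<delta>_def using assms EB j' B_normalizes_P[of j' j] by (intro conj_by_pi_skip_P) auto
  then have \<delta>: "\<delta> \<in> carrier G" using P_closed[of "Suc j"] assms by auto
  have "?\<pi> \<otimes> comb p m = \<delta> \<otimes> (?\<pi> \<otimes> comb p' m)" if "j \<le> m" "m \<le> n" for m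
    using that
  proof (induction m rule: dec_induct)
    case base
    have "comb p j = comb p j' \<otimes> p j" unfolding j' by (rule comb_Suc) (use cl assms j' in auto)
    moreover have "comb p' j = comb p' j' \<otimes> p' j"
      unfolding j' by (rule comb_Suc) (use cl' assms j' in auto)
    moreover have "comb p' j' = comb p j'" by (rule comb_cong) (auto simp: j' p'_def)
    moreover have "p' j = \<one>" by (simp add: p'_def)
    ultimately show ?case
      using E \<pi> cl[of j] assms by (simp add: \<delta>_def conj_by_def m_assoc)
  next
    case (step m)
    have c: "comb p m \<in> carrier G" "comb p' m \<in> carrier G"
      using comb_in_B[of m p] comb_in_B[of m p'] B_closed[of m] p p'P step by auto
    have pS: "p (Suc m) \<in> carrier G" "p' (Suc m) = p (Suc m)" using cl step by (auto simp: p'_def)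
    have "comb p (Suc m) = comb p m \<otimes> p (Suc m)" by (rule comb_Suc) (use cl step in auto)
    moreover have "comb p' (Suc m) = comb p' m \<otimes> p' (Suc m)"
      by (rule comb_Suc) (use cl' step in auto)
    moreover have "?\<pi> \<otimes> comb p m \<otimes> p (Suc m) = \<delta> \<otimes> (?\<pi> \<otimes> comb p' m) \<otimes> p (Suc m)"
      using step by simp
    ultimately show ?case using c pS \<pi> \<delta> by (simp add: m_assoc)
  qed
  then have eq: "?\<pi> \<otimes> comb p n = \<delta> \<otimes> (?\<pi> \<otimes> comb p' n)" using assms by simp
  obtain q where q: "\<forall>i. 1 \<le> i \<longrightarrow> i \<le> n \<longrightarrow> q i \<in> P i" "\<forall>i<Suc j. q i = p' i"
      "comb p' n \<otimes> \<delta> = comb q n"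
    using comb_absorb[of "Suc j" n \<delta> p'] \<delta>P p'P assms by auto
  have c: "comb p' n \<in> carrier G" using comb_in_B[of n p'] B_closed[of n] p'P by auto
  have "conj_by (inv \<delta>) (?\<pi> \<otimes> comb p n) = ?\<pi> \<otimes> comb q n"
    unfolding eq q(3)[symmetric] using \<delta> \<pi> c by (simp add: conj_by_def m_assoc)
  then show ?thesis using q \<delta> by (intro bexI[of _ "inv \<delta>"] exI[of _ q]) (auto simp: p'_def)
qed

text \<open>Invariant of the sweep: below \<open>k\<close> only the factors at break points survive.
  The step at \<open>k\<close> preserves this because it leaves the factors of smaller index
  unchanged.\<close>

lemma sweep:
  assumes "\<And>i. 1 \<le> i \<Longrightarrow> i \<le> n \<Longrightarrow> p i \<in> P i" and "k \<le> n"
  shows "\<exists>\<gamma> \<in> carrier G. \<exists>q. (\<forall>i. 1 \<le> i \<longrightarrow> i \<le> n \<longrightarrow> q i \<in> P i) \<and>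
    (\<forall>i. 1 \<le> i \<longrightarrow> i < k \<longrightarrow> i \<notin> S \<longrightarrow> q i = \<one>) \<and>
    conj_by \<gamma> (pi_skip S n \<otimes> comb p n) = pi_skip S n \<otimes> comb q n"
  using assms(2)
proof (induction k)
  case 0
  have "pi_skip S n \<in> carrier G" "comb p n \<in> carrier G"
    using pi_skip_in_B comb_in_B[of n p] B_closed[of n] assms by auto
  then show ?case using assms by (intro bexI[of _ \<one>] exI[of _ p]) auto
next
  case (Suc k)
  then obtain \<gamma> q where q: "\<gamma> \<in> carrier G" "\<And>i. 1 \<le> i \<Longrightarrow> i \<le> n \<Longrightarrow> q i \<in> P i"
      "\<And>i. 1 \<le> i \<Longrightarrow> i < k \<Longrightarrow> i \<notin> S \<Longrightarrow> q i = \<one>"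
      "conj_by \<gamma> (pi_skip S n \<otimes> comb p n) = pi_skip S n \<otimes> comb q n" by auto
  show ?case
  proof (cases "1 \<le> k \<and> k \<notin> S")
    case True
    then obtain \<delta> q' where q': "\<delta> \<in> carrier G" "\<forall>i. 1 \<le> i \<longrightarrow> i \<le> n \<longrightarrow> q' i \<in> P i"
        "\<forall>i<k. q' i = q i" "q' k = \<one>"
        "conj_by \<delta> (pi_skip S n \<otimes> comb q n) = pi_skip S n \<otimes> comb q' n"
      using sweep_step[of k S q] q(2) Suc.prems by auto
    have "pi_skip S n \<in> carrier G" "comb p n \<in> carrier G"
      using pi_skip_in_B comb_in_B[of n p] B_closed[of n] assms by auto
    then have "conj_by (\<delta> \<otimes> \<gamma>) (pi_skip S n \<otimes> comb p n) = pi_skip S n \<otimes> comb q' n"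
      using q q' by (simp add: conj_by_mult_left)
    moreover have "q' i = \<one>" if "1 \<le> i" "i < Suc k" "i \<notin> S" for i
      using that q q' by (auto simp: less_Suc_eq)
    ultimately show ?thesis using q q' by (intro bexI[of _ "\<delta> \<otimes> \<gamma>"] exI[of _ q']) auto
  next
    case False
    have "q i = \<one>" if "1 \<le> i" "i < Suc k" "i \<notin> S" for i
      using that q(3) False by (auto simp: less_Suc_eq)
    then show ?thesis using q by (intro bexI[of _ \<gamma>] exI[of _ q]) auto
  qed
qed

end

section \<open>Conjugacy in the Coxeter quotient\<close>

text \<open>The Coxeter relations of the symmetric group; they hold modulo pure braids because the
  square of \<open>s i\<close> is \<open>A i (Suc i)\<close>.\<close>

locale coxeter_gens = braid_gens +
  assumes s_invol: "1 \<le> i \<Longrightarrow> i < n \<Longrightarrow> s i \<otimes> s i = \<one>"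
begin

lemma inv_s: "1 \<le> i \<Longrightarrow> i < n \<Longrightarrow> inv (s i) = s i"
  using s_invol by (simp add: inv_equality)

text \<open>Involutive generators are their own inverses, so right multiplication by generators
  alone reaches all of \<open>B k\<close>.\<close>

lemma B_induct [consumes 2, case_names one mult]:
  assumes "k \<le> n" "x \<in> B k" and one: "Q \<one>"
    and mult: "\<And>x i. x \<in> B k \<Longrightarrow> Q x \<Longrightarrow> 1 \<le> i \<Longrightarrow> i < k \<Longrightarrow> Q (x \<otimes> s i)"
  shows "Q x"
proof -
  \<comment> \<open>The extra left factor \<open>y\<close> lets a product of two generated elements
    be handled by applying their induction hypotheses one after the other.\<close>
  have "y \<in> B k \<and> Q y \<longrightarrow> y \<otimes> x \<in> B k \<and> Q (y \<otimes> x)" for y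
    using assms(2) unfolding B_def
  proof (induction arbitrary: y rule: generate.induct)
    case one
    then show ?case using B_closed[OF assms(1)] by (auto simp: B_def)
  next
    case (incl h)
    then show ?case using mult by (auto simp: B_def intro: generate.eng generate.incl)
  next
    case (inv h)
    then obtain i where i: "h = s i" "1 \<le> i" "i < k" by auto
    then have "inv h = h" using assms(1) by (simp add: inv_s)
    moreover have "s i \<in> generate G (s ` {1..<k})" using s_in_B i by (auto simp: B_def)
    ultimately show ?case using i mult by (auto simp: B_def intro: generate.eng)
  next
    case (eng h1 h2)
    have "h1 \<in> carrier G" "h2 \<in> carrier G"
      using eng.hyps B_closed[OF assms(1)] by (auto simp: B_def)
    then show ?case using eng.IH B_closed[OF assms(1)] by (auto simp: B_def m_assoc [symmetric])
  qed
  from this[of \<one>] show ?thesis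
    using one assms B_closed generate.one[of G] by (auto simp: B_def)
qed

text \<open>In the symmetric group this separates the permutations fixing the last point from the
  others. The union of the two sets is closed under right multiplication by generators: when the top
  generator occurs twice, the element between its occurrences is decomposed one level lower, and
  then either the two occurrences cancel or the braid relation merges them into one.\<close>

lemma B_double_coset:
  "m < n \<Longrightarrow> x \<in> B (Suc m) \<Longrightarrow>
     x \<in> B m \<or> (1 \<le> m \<and> (\<exists>y \<in> B m. \<exists>z \<in> B m. x = y \<otimes> s m \<otimes> z))"
proof (induction m arbitrary: x)
  case 0
  then show ?case by (simp add: B_def)
next
  case (Suc m)
  let ?m = "Suc m"
  have H: "subgroup (B ?m) G" "subgroup (B m) G" using Suc.prems B_subgroup by auto
  have Bmm: "B m \<subseteq> B ?m" by (rule B_mono) simp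
  have sm: "s ?m \<in> carrier G" using Suc.prems by simp
  have comm: "y \<otimes> s ?m = s ?m \<otimes> y" if "y \<in> B m" for y
    using B_commute[of m ?m y] that Suc.prems by simp
  have one: "\<one> \<in> B ?m" using subgroup.one_closed H by auto
  have "Suc ?m \<le> n" using Suc.prems by simp
  from this Suc.prems(2) show ?case
  proof (induction rule: B_induct)
    case one
    then show ?case using \<open>\<one> \<in> B ?m\<close> by simp
  next
    case (mult x i)
    consider "i < ?m" | "i = ?m" using mult by linarith
    then show ?case
    proof cases
      case 1
      then have si: "s i \<in> B ?m" using s_in_B mult by auto
      from mult.IH show ?thesis
      proof
        assume "x \<in> B ?m"
        then show ?thesis using si subgroup.m_closed[OF H(1)] by auto
      next
        assume "1 \<le> ?m \<and> (\<exists>y\<in>B ?m. \<exists>z\<in>B ?m. x = y \<otimes> s ?m \<otimes> z)"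
        then obtain y z where yz: "y \<in> B ?m" "z \<in> B ?m" "x = y \<otimes> s ?m \<otimes> z" by auto
        then have "x \<otimes> s i = y \<otimes> s ?m \<otimes> (z \<otimes> s i)"
          using si sm subgroup.mem_carrier[OF H(1)] by (simp add: m_assoc)
        then show ?thesis using yz si subgroup.m_closed[OF H(1)] by auto
      qed
    next
      case 2
      from mult.IH show ?thesis
      proof
        assume x: "x \<in> B ?m"
        then have "x \<otimes> s i = x \<otimes> s ?m \<otimes> \<one>"
          using sm subgroup.mem_carrier[OF H(1)] by (simp add: 2)
        then show ?thesis using x one by auto
      next
        assume "1 \<le> ?m \<and> (\<exists>y\<in>B ?m. \<exists>z\<in>B ?m. x = y \<otimes> s ?m \<otimes> z)"
        then obtain y z where yz: "y \<in> B ?m" "z \<in> B ?m" "x = y \<otimes> s ?m \<otimes> z" by auto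
        then have cl: "y \<in> carrier G" "z \<in> carrier G" using subgroup.mem_carrier[OF H(1)] by auto
        from Suc.IH[OF _ yz(2)] Suc.prems
        have "z \<in> B m \<or> (1 \<le> m \<and> (\<exists>u\<in>B m. \<exists>v\<in>B m. z = u \<otimes> s m \<otimes> v))" by simp
        then show ?thesis
        proof
          assume z: "z \<in> B m"
          then have "x \<otimes> s i = y \<otimes> (s ?m \<otimes> (s ?m \<otimes> z))"
            using yz cl sm comm by (simp add: 2 m_assoc)
          also have "\<dots> = y \<otimes> z"
            using cl sm s_invol[of ?m] Suc.prems by (simp add: m_assoc [symmetric])
          finally show ?thesis using yz subgroup.m_closed[OF H(1)] by auto
        next
          assume "1 \<le> m \<and> (\<exists>u\<in>B m. \<exists>v\<in>B m. z = u \<otimes> s m \<otimes> v)"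
          then obtain u v where uv: "1 \<le> m" "u \<in> B m" "v \<in> B m" "z = u \<otimes> s m \<otimes> v" by auto
          then have cl': "u \<in> carrier G" "v \<in> carrier G" using subgroup.mem_carrier[OF H(2)] by auto
          have m: "s m \<in> carrier G" "s m \<in> B ?m" using uv Suc.prems by (auto intro: s_in_B)
          have "x \<otimes> s i = y \<otimes> (s ?m \<otimes> u) \<otimes> s m \<otimes> (v \<otimes> s ?m)"
            using yz uv cl cl' sm m by (simp add: 2 m_assoc)
          also have "\<dots> = y \<otimes> u \<otimes> (s ?m \<otimes> (s m \<otimes> (s ?m \<otimes> v)))"
            using comm[OF uv(2)] comm[OF uv(3)] cl cl' sm m by (metis m_assoc m_closed)
          also have "\<dots> = y \<otimes> u \<otimes> (s m \<otimes> (s ?m \<otimes> (s m \<otimes> v)))"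
            using s_braid'[of m v] uv cl' Suc.prems by simp
          also have "\<dots> = (y \<otimes> u \<otimes> s m) \<otimes> s ?m \<otimes> (s m \<otimes> v)"
            using cl cl' sm m by (simp add: m_assoc)
          finally have "x \<otimes> s i = (y \<otimes> u \<otimes> s m) \<otimes> s ?m \<otimes> (s m \<otimes> v)" .
          moreover have "y \<otimes> u \<otimes> s m \<in> B ?m" "s m \<otimes> v \<in> B ?m"
            using yz uv m Bmm subgroup.m_closed[OF H(1)] by auto
          ultimately show ?thesis by auto
        qed
      qed
    qed
  qed
qed

text \<open>
  The double coset decomposition lets the conjugation proceed by stripping the generator of
  largest index from the element and appending it to the increasing product on its right.
\<close>

lemma conj_to_pi_skip_aux:
  "Suc k \<le> l \<Longrightarrow> l \<le> n \<Longrightarrow> r \<in> B (Suc k) \<Longrightarrow>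
     \<exists>\<gamma> \<in> B l. \<exists>S. conj_by \<gamma> (r \<otimes> list_mult G (map s [Suc k..<l])) = pi_skip S l"
proof (induction k arbitrary: l r)
  case 0
  then have "r = \<one>" by (simp add: B_def generate_empty)
  moreover have "list_mult G (map s [1..<l]) = pi_skip {} l" by (simp add: pi_skip_def)
  moreover have "\<one> \<in> B l" using subgroup.one_closed B_subgroup 0 by auto
  moreover have "pi_skip {} l \<in> carrier G" using pi_skip_in_B B_closed 0 by auto
  ultimately show ?case by (intro bexI[of _ \<one>] exI[of _ "{}"]) auto
next
  case (Suc k)
  let ?m = "Suc k"
  let ?w = "list_mult G (map s [Suc ?m..<l])"
  have w: "?w \<in> carrier G" by (rule list_mult_closed) (use Suc.prems in auto)
  have comm: "z \<otimes> ?w = ?w \<otimes> z" if "z \<in> B ?m" for z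
    using B_closed[of ?m] B_commute[of ?m _ z] that Suc.prems
    by (intro list_mult_commute[symmetric]) auto
  have cl: "z \<in> carrier G" if "z \<in> B ?m" for z using that Suc.prems B_closed[of ?m] by auto
  have mono: "B ?m \<subseteq> B l" using B_mono Suc.prems by simp
  have sm: "s ?m \<in> carrier G" using Suc.prems by simp
  have "?m < n" using Suc.prems by simp
  from B_double_coset[OF this Suc.prems(3)] show ?case
  proof
    assume r: "r \<in> B ?m"
    \<comment> \<open>Here the top generator is absent from \<open>r\<close>, and the induction
      hypothesis is used with an empty trailing product. It yields a conjugator in
      \<open>B ?m\<close>, which commutes with \<open>?w\<close>.\<close>
    obtain \<gamma> S where \<gamma>: "\<gamma> \<in> B ?m" "conj_by \<gamma> r = pi_skip S ?m"
      using Suc.IH[of ?m r] r Suc.prems cl by auto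
    \<comment> \<open>The index \<open>?m\<close> is now skipped. Intersecting removes members of
      \<open>S\<close> above it, which would wrongly skip generators of \<open>?w\<close>.\<close>
    let ?S = "S \<inter> {1..<?m} \<union> {?m}"
    have "[1..<l] = [1..<?m] @ ?m # [Suc ?m..<l]" by (rule upt_split) (use Suc.prems in auto)
    moreover have "filter (\<lambda>i. i \<notin> ?S) [1..<?m] = filter (\<lambda>i. i \<notin> S) [1..<?m]"
      by (rule filter_cong) auto
    moreover have "filter (\<lambda>i. i \<notin> ?S) [Suc ?m..<l] = [Suc ?m..<l]"
      by (rule filter_True) auto
    ultimately have "filter (\<lambda>i. i \<notin> ?S) [1..<l] = filter (\<lambda>i. i \<notin> S) [1..<?m] @ [Suc ?m..<l]"
      by (simp del: upt_Suc)
    then have "pi_skip ?S l = list_mult G (map s (filter (\<lambda>i. i \<notin> S) [1..<?m]) @ map s [Suc ?m..<l])"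
      by (simp add: pi_skip_def del: upt_Suc)
    also have "\<dots> = pi_skip S ?m \<otimes> ?w"
      unfolding pi_skip_def by (rule list_mult_append) (use Suc.prems in auto)
    also have "\<dots> = conj_by \<gamma> r \<otimes> conj_by \<gamma> ?w"
      using \<gamma> conj_by_fix_iff[of \<gamma> ?w] comm cl w by auto
    also have "\<dots> = conj_by \<gamma> (r \<otimes> ?w)" using \<gamma> r cl w by (simp add: conj_by_mult)
    finally show ?thesis using \<gamma> mono by (metis subsetD)
  next
    assume "1 \<le> ?m \<and> (\<exists>y\<in>B ?m. \<exists>z\<in>B ?m. r = y \<otimes> s ?m \<otimes> z)"
    then obtain y z where yz: "y \<in> B ?m" "z \<in> B ?m" "r = y \<otimes> s ?m \<otimes> z" by auto
    have zy: "z \<otimes> y \<in> B ?m" using yz subgroup.m_closed[OF B_subgroup] Suc.prems by auto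
    have "[?m..<l] = ?m # [Suc ?m..<l]" using Suc.prems by (simp add: upt_conv_Cons)
    then have sw: "list_mult G (map s [?m..<l]) = s ?m \<otimes> ?w" by simp
    obtain \<gamma> S where \<gamma>: "\<gamma> \<in> B l" "conj_by \<gamma> (z \<otimes> y \<otimes> (s ?m \<otimes> ?w)) = pi_skip S l"
      using Suc.IH[OF _ _ zy, of l] Suc.prems sw by auto
    \<comment> \<open>Conjugation by \<open>z\<close> rotates it from behind the top generator to
      the front, since it commutes with \<open>?w\<close>. The top generator thereby becomes the
      first letter of the increasing product.\<close>
    have "conj_by z (r \<otimes> ?w) = z \<otimes> y \<otimes> (s ?m \<otimes> (z \<otimes> ?w \<otimes> inv z))"
      using yz cl w sm by (simp add: conj_by_def m_assoc)
    also have "z \<otimes> ?w \<otimes> inv z = ?w" using comm[OF yz(2)] cl yz w by (simp add: m_assoc)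
    finally have "conj_by (\<gamma> \<otimes> z) (r \<otimes> ?w) = pi_skip S l"
      using \<gamma> yz cl w sm B_closed[OF Suc.prems(2)] by (simp add: conj_by_mult_left)
    moreover have "\<gamma> \<otimes> z \<in> B l"
      using \<gamma> yz mono subgroup.m_closed[OF B_subgroup] Suc.prems by auto
    ultimately show ?thesis by blast
  qed
qed

lemma conj_to_pi_skip:
  assumes "1 \<le> n" "r \<in> B n"
  shows "\<exists>\<gamma> \<in> carrier G. \<exists>S. conj_by \<gamma> r = pi_skip S n"
proof -
  obtain k where "n = Suc k" using assms(1) by (cases n) auto
  then show ?thesis
    using conj_to_pi_skip_aux[of k n r] assms(2) B_closed[of n] by (auto 0 3)
qed

end

section \<open>Lifting conjugacy from the quotient by pure braids\<close>

lemma (in group_hom) hom_list_mult: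
  "set xs \<subseteq> carrier G \<Longrightarrow> h (list_mult G xs) = list_mult H (map h xs)"
  by (induction xs) auto

context braid_gens
begin

lemma conj_to_pi_skip_mod_PB:
  assumes "1 \<le> n" and gen: "carrier G = B n" and b: "b \<in> carrier G"
  shows "\<exists>\<gamma> \<in> carrier G. \<exists>S. \<exists>\<nu> \<in> PB n. conj_by \<gamma> b = pi_skip S n \<otimes> \<nu>"
proof -
  let ?N = "PB n"
  let ?Q = "G Mod ?N"
  let ?h = "\<lambda>x. ?N #> x"
  interpret N: normal ?N G using PB_normal[OF gen] .
  interpret h: group_hom G ?Q ?h
    using N.factorgroup_is_group N.r_coset_hom_Mod is_group
    by (intro group_hom.intro group_hom_axioms.intro)
  have N_one: "?h x = \<one>\<^bsub>?Q\<^esub>" if "x \<in> ?N" for x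
    using that N.rcos_const by (simp add: FactGroup_def)
  interpret Q: coxeter_gens ?Q n "\<lambda>i. ?h (s i)"
  proof unfold_locales
    fix i assume i: "1 \<le> i" "i < n"
    then show "?h (s i) \<in> carrier ?Q" by simp
    have "s i \<otimes> s i \<in> ?N" using A_in_PB[of i "Suc i" n] i by simp
    then have "?h (s i \<otimes> s i) = \<one>\<^bsub>?Q\<^esub>" by (rule N_one)
    then show "?h (s i) \<otimes>\<^bsub>?Q\<^esub> ?h (s i) = \<one>\<^bsub>?Q\<^esub>"
      using i h.hom_mult[of "s i" "s i"] by simp
  next
    fix i j assume "1 \<le> i" "i + 2 \<le> j" "j < n"
    then show "?h (s i) \<otimes>\<^bsub>?Q\<^esub> ?h (s j) = ?h (s j) \<otimes>\<^bsub>?Q\<^esub> ?h (s i)"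
      using s_commute[of i j] h.hom_mult[of "s i" "s j"] h.hom_mult[of "s j" "s i"] by simp
  next
    fix i assume i: "1 \<le> i" "Suc i < n"
    have "?h x \<otimes>\<^bsub>?Q\<^esub> ?h y \<otimes>\<^bsub>?Q\<^esub> ?h x = ?h (x \<otimes> y \<otimes> x)"
      if "x \<in> carrier G" "y \<in> carrier G" for x y
      using that by (simp only: h.hom_mult m_closed)
    then show "?h (s i) \<otimes>\<^bsub>?Q\<^esub> ?h (s (Suc i)) \<otimes>\<^bsub>?Q\<^esub> ?h (s i) =
        ?h (s (Suc i)) \<otimes>\<^bsub>?Q\<^esub> ?h (s i) \<otimes>\<^bsub>?Q\<^esub> ?h (s (Suc i))"
      using i s_braid[of i] by (metis Suc_lessD le_Suc_eq s_closed)
  qed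
  have "?h b \<in> Q.B n"
    using b[unfolded gen B_def] unfolding Q.B_def
  proof (induction rule: generate.induct)
    case one
    then show ?case using generate.one[of ?Q "(\<lambda>i. ?h (s i)) ` {1..<n}"] by simp
  next
    case (incl x)
    then show ?case by (intro generate.incl) auto
  next
    case (inv x)
    then have "?h (inv x) = inv\<^bsub>?Q\<^esub> (?h x)" by (intro h.hom_inv) auto
    then show ?case using inv by (auto intro: generate.inv)
  next
    case (eng x y)
    then have "x \<in> carrier G" "y \<in> carrier G" using generate_in_carrier[OF s_image] by auto
    then show ?case using generate.eng[OF eng.IH] h.hom_mult[of x y] by simp
  qed
  then obtain g S where g: "g \<in> carrier ?Q" "group.conj_by ?Q g (?h b) = Q.pi_skip S n"
    using Q.conj_to_pi_skip assms by blast
  from g(1) obtain \<gamma> where \<gamma>: "\<gamma> \<in> carrier G" "g = ?h \<gamma>"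
    by (auto simp: FactGroup_def RCOSETS_def)
  have \<pi>: "pi_skip S n \<in> carrier G" using pi_skip_in_B gen by auto
  have "?h (pi_skip S n) = Q.pi_skip S n"
    unfolding pi_skip_def Q.pi_skip_def by (subst h.hom_list_mult) (auto simp: comp_def)
  also have "\<dots> = ?h (conj_by \<gamma> b)"
    using \<gamma> b g by (simp add: group.conj_by_def[OF N.factorgroup_is_group] conj_by_def)
  finally have "conj_by \<gamma> b \<in> ?h (pi_skip S n)"
    using rcos_self[OF _ N.subgroup_axioms, of "conj_by \<gamma> b"] \<gamma> b by simp
  then obtain \<mu> where \<mu>: "\<mu> \<in> ?N" "conj_by \<gamma> b = \<mu> \<otimes> pi_skip S n"
    by (auto simp: r_coset_def)
  \<comment> \<open>Cosets are right cosets, so the pure error stands on the left of the product;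
    normality moves it to the right, where it will be combed.\<close>
  have "conj_by (inv (pi_skip S n)) \<mu> \<in> ?N"
    unfolding conj_by_def by (rule N.inv_op_closed2) (use \<pi> \<mu> in auto)
  moreover have "conj_by \<gamma> b = pi_skip S n \<otimes> conj_by (inv (pi_skip S n)) \<mu>"
    using \<mu> \<pi> N.mem_carrier by (simp add: conj_by_def m_assoc)
  ultimately show ?thesis using \<gamma> by blast
qed

lemma conj_to_pi_skip_comb:
  assumes "1 \<le> n" "carrier G = B n" "b \<in> carrier G"
  shows "\<exists>\<gamma> \<in> carrier G. \<exists>S q. (\<forall>i. 1 \<le> i \<longrightarrow> i \<le> n \<longrightarrow> q i \<in> P i) \<and>
    (\<forall>i. 1 \<le> i \<longrightarrow> i < n \<longrightarrow> i \<notin> S \<longrightarrow> q i = \<one>) \<and> conj_by \<gamma> b = pi_skip S n \<otimes> comb q n"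
proof -
  obtain \<gamma> S \<nu> where 1: "\<gamma> \<in> carrier G" "\<nu> \<in> PB n" "conj_by \<gamma> b = pi_skip S n \<otimes> \<nu>"
    using conj_to_pi_skip_mod_PB[OF assms] by blast
  then obtain p where 2: "\<forall>i. 1 \<le> i \<longrightarrow> i \<le> n \<longrightarrow> p i \<in> P i" "\<nu> = comb p n"
    using PB_comb by blast
  then obtain \<delta> q where 3: "\<delta> \<in> carrier G" "\<forall>i. 1 \<le> i \<longrightarrow> i \<le> n \<longrightarrow> q i \<in> P i"
      "\<forall>i. 1 \<le> i \<longrightarrow> i < n \<longrightarrow> i \<notin> S \<longrightarrow> q i = \<one>"
      "conj_by \<delta> (pi_skip S n \<otimes> comb p n) = pi_skip S n \<otimes> comb q n"
    using sweep[of p n S] by auto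
  have "conj_by (\<delta> \<otimes> \<gamma>) b = pi_skip S n \<otimes> comb q n"
    using 1 2 3 assms by (simp add: conj_by_mult_left)
  then show ?thesis using 1 3 by (intro bexI[of _ "\<delta> \<otimes> \<gamma>"] exI[of _ S] exI[of _ q]) auto
qed

end

section \<open>Woven braids\<close>

text \<open>The parts are the gaps between consecutive break points, found by recursion on the
  largest break point \<open>k\<close> below \<open>n\<close>, with last part \<open>n - k\<close>.
  Equality of lists rather than sets is needed because the pure factors are multiplied in this
  order.\<close>

lemma composition_of_breakpoints:
  fixes n :: nat
  assumes "1 \<le> n"
  shows "\<exists>ns. (\<forall>d \<in> set ns. 0 < d) \<and> sum_list ns = n \<and>
    map (\<lambda>m. sum_list (take (Suc m) ns)) [0..<length ns] =
      filter (\<lambda>i. i \<in> S \<or> i = n) [1..<Suc n]"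
  using assms
proof (induction n rule: less_induct)
  case (less n)
  show ?case
  proof (cases "S \<inter> {1..<n} = {}")
    case True
    have "filter (\<lambda>i. i \<in> S \<or> i = n) [1..<n] = []"
      using True by (auto simp: filter_empty_conv)
    then show ?thesis using less.prems by (intro exI[of _ "[n]"]) auto
  next
    case False
    define k where "k = Max (S \<inter> {1..<n})"
    have "k \<in> S \<inter> {1..<n}" unfolding k_def using False by (intro Max_in) auto
    then have k: "k \<in> S" "1 \<le> k" "k < n" by auto
    have gap: "i \<notin> S" if "k < i" "i < n" for i
    proof
      assume "i \<in> S"
      then have "i \<le> k" unfolding k_def using that k by (intro Max_ge) auto
      then show False using that by simp
    qed
    obtain ns where ns: "\<forall>d \<in> set ns. 0 < d" "sum_list ns = k"
        "map (\<lambda>m. sum_list (take (Suc m) ns)) [0..<length ns] =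
          filter (\<lambda>i. i \<in> S \<or> i = k) [1..<Suc k]"
      using less.IH[of k] k by blast
    have "[1..<n] = [1..<Suc k] @ [Suc k..<n]"
      using upt_add_eq_append[of 1 "Suc k" "n - Suc k"] k by simp
    then have split: "[1..<Suc n] = [1..<Suc k] @ [Suc k..<n] @ [n]" using k by simp
    have "filter (\<lambda>i. i \<in> S \<or> i = n) [Suc k..<n] = []"
      using gap by (auto simp: filter_empty_conv)
    moreover have "filter (\<lambda>i. i \<in> S \<or> i = n) [1..<Suc k] = filter (\<lambda>i. i \<in> S \<or> i = k) [1..<Suc k]"
      using k by (intro filter_cong) auto
    ultimately have "filter (\<lambda>i. i \<in> S \<or> i = n) [1..<Suc n] =
        map (\<lambda>m. sum_list (take (Suc m) ns)) [0..<length ns] @ [n]"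
      unfolding split ns(3) by (simp del: upt_Suc)
    moreover have "map (\<lambda>m. sum_list (take (Suc m) (ns @ [n - k]))) [0..<length ns] =
        map (\<lambda>m. sum_list (take (Suc m) ns)) [0..<length ns]"
      by (rule map_cong) auto
    ultimately show ?thesis using ns(1,2) k by (intro exI[of _ "ns @ [n - k]"]) auto
  qed
qed

section \<open>The group of braid words as an instance\<close>

lemma braid_class_eqI: "braid_equiv n u v \<Longrightarrow> braid_rel n `` {u} = braid_rel n `` {v}"
  by (rule equiv_class_eq[OF equiv_braid_rel]) (simp add: braid_rel_def)

lemma braid_class_closed: "u \<in> braid_words n \<Longrightarrow> braid_rel n `` {u} \<in> carrier (braid_group n)"
  by (simp add: braid_group_def quotientI)

interpretation braid: braid_gens "braid_group n" n "braid_gen n" for n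
proof (intro braid_gens.intro braid_gens_axioms.intro group_braid_group)
  fix i assume "1 \<le> i" "i < n"
  then show "braid_gen n i \<in> carrier (braid_group n)"
    unfolding braid_gen_def by (intro braid_class_closed) (simp add: braid_words_def)
next
  fix i j assume "1 \<le> i" "i + 2 \<le> j" "j < n"
  then show "braid_gen n i \<otimes>\<^bsub>braid_group n\<^esub> braid_gen n j =
      braid_gen n j \<otimes>\<^bsub>braid_group n\<^esub> braid_gen n i"
    using braid_class_eqI[OF braid_equiv.commute[of i n j]]
    by (simp add: braid_gen_def braid_class_mult braid_words_def)
next
  fix i assume "1 \<le> i" "Suc i < n"
  then show "braid_gen n i \<otimes>\<^bsub>braid_group n\<^esub> braid_gen n (Suc i) \<otimes>\<^bsub>braid_group n\<^esub> braid_gen n i =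
      braid_gen n (Suc i) \<otimes>\<^bsub>braid_group n\<^esub> braid_gen n i \<otimes>\<^bsub>braid_group n\<^esub> braid_gen n (Suc i)"
    using braid_class_eqI[OF braid_equiv.braid[of i n]]
    by (simp add: braid_gen_def braid_class_mult braid_words_def)
qed

text \<open>Every letter represents a generator or its inverse. This supplies the generation
  hypothesis behind the normality of the pure braid group.\<close>

lemma braid_carrier: "carrier (braid_group n) = braid.B n n"
proof
  have word_class: "braid_rel n `` {u} \<in> braid.B n n" if "u \<in> braid_words n" for u
    using that
  proof (induction u)
    case Nil
    have "braid_rel n `` {[]} = \<one>\<^bsub>braid_group n\<^esub>" by (simp add: braid_group_def)
    then show ?case using generate.one by (simp add: braid.B_def)
  next
    case (Cons a u)
    obtain i b where a: "a = (i, b)" by force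
    have i: "1 \<le> i" "i < n" and u: "u \<in> braid_words n" using Cons.prems by (auto simp: a braid_words_def)
    have w: "[(i, c)] \<in> braid_words n" for c using i by (simp add: braid_words_def)
    have gen: "braid_gen n i \<in> braid.B n n" using i by (rule braid.s_in_B)
    have "braid_rel n `` {[(i, b)]} \<in> braid.B n n"
    proof (cases b)
      case True
      then show ?thesis using gen by (simp add: braid_gen_def)
    next
      case False
      have "braid_rel n `` {[(i, False), (i, True)]} = braid_rel n `` {[]}"
        using braid_class_eqI[OF braid_equiv.cancel[of i n False]] i by simp
      then have "braid_rel n `` {[(i, False)]} \<otimes>\<^bsub>braid_group n\<^esub> braid_gen n i = \<one>\<^bsub>braid_group n\<^esub>"
        using braid_class_mult[OF w w, of False True] by (simp add: braid_gen_def braid_group_def)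
      then have "braid_rel n `` {[(i, b)]} = inv\<^bsub>braid_group n\<^esub> (braid_gen n i)"
        using braid.inv_equality[symmetric] braid_class_closed[OF w] i False by simp
      then show ?thesis
        using gen subgroup.m_inv_closed[OF braid.B_subgroup[OF order_refl]] by simp
    qed
    moreover have "braid_rel n `` {a # u} =
        braid_rel n `` {[(i, b)]} \<otimes>\<^bsub>braid_group n\<^esub> braid_rel n `` {u}"
      using braid_class_mult[OF w u] by (simp add: a)
    ultimately show ?case
      using Cons.IH[OF u] subgroup.m_closed[OF braid.B_subgroup[OF order_refl]] by simp
  qed
  then show "carrier (braid_group n) \<subseteq> braid.B n n"
    by (auto simp: braid_group_def elim!: quotientE)
  show "braid.B n n \<subseteq> carrier (braid_group n)"
    using braid.B_closed by blast
qed

text \<open>Raising \<open>j\<close> by one adds a generator at the outer left end and its inverse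
  at the outer right end, which is the recursion of \<open>A\<close>; at \<open>j = i + 1\<close>
  both outer products are empty.\<close>

lemma pure_gen_eq_A:
  assumes "1 \<le> i" "i < j" "j \<le> n"
  shows "pure_gen n i j = braid.A n i j"
proof -
  let ?G = "braid_group n" and ?s = "braid_gen n"
  let ?U = "\<lambda>j. list_mult ?G (map ?s (rev [i + 1..<j]))"
  let ?V = "\<lambda>j. list_mult ?G (map (\<lambda>m. inv\<^bsub>?G\<^esub> (?s m)) [i + 1..<j])"
  have "?U j \<otimes>\<^bsub>?G\<^esub> (?s i [^]\<^bsub>?G\<^esub> (2::nat)) \<otimes>\<^bsub>?G\<^esub> ?V j = braid.A n i j"
    using Suc_leI[OF assms(2)] assms(3)
  proof (induction j rule: dec_induct)
    case base
    then show ?case using assms(1) by (simp add: numeral_2_eq_2)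
  next
    case (step j)
    have U: "?U j \<in> carrier ?G"
      by (rule braid.list_mult_closed) (use step assms in auto)
    have V: "?V j \<in> carrier ?G"
      by (rule braid.list_mult_closed) (use step assms in auto)
    have s: "?s j \<in> carrier ?G" "?s i \<in> carrier ?G" using step assms by auto
    have "?U (Suc j) = ?s j \<otimes>\<^bsub>?G\<^esub> ?U j" using step by simp
    moreover have "?V (Suc j) = ?V j \<otimes>\<^bsub>?G\<^esub> inv\<^bsub>?G\<^esub> (?s j)"
    proof -
      have "?V (Suc j) = list_mult ?G (map (\<lambda>m. inv\<^bsub>?G\<^esub> (?s m)) [i + 1..<j] @ [inv\<^bsub>?G\<^esub> (?s j)])"
        using step by simp
      also have "\<dots> = ?V j \<otimes>\<^bsub>?G\<^esub> inv\<^bsub>?G\<^esub> (?s j)"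
        by (subst braid.list_mult_append) (use step assms s in auto)
      finally show ?thesis .
    qed
    moreover have "braid.A n i (Suc j) = braid.conj_by n (?s j) (braid.A n i j)" using step by simp
    ultimately show ?case
      using step U V s by (simp add: braid.conj_by_def braid.m_assoc flip: step.IH)
  qed
  then show ?thesis by (simp add: pure_gen_def)
qed

lemma pure_j_braids_eq_P:
  assumes "j \<le> n"
  shows "pure_j_braids n j = braid.P n j"
proof -
  have "{pure_gen n i j |i. 1 \<le> i \<and> i < j} = {braid.A n i j |i. 1 \<le> i \<and> i < j}"
    using pure_gen_eq_A[OF _ _ assms] by (metis (no_types, lifting))
  then show ?thesis by (simp add: pure_j_braids_def braid.P_def)
qed

lemma woven_pi_eq_pi_skip:
  assumes "sum_list ns = n"
    and "map (\<lambda>m. sum_list (take (Suc m) ns)) [0..<length ns] =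
      filter (\<lambda>i. i \<in> S \<or> i = n) [1..<Suc n]"
  shows "woven_pi ns = braid.pi_skip n S n"
proof -
  define ps where "ps m = sum_list (take m ns)" for m
  define T where "T = {sum_list (take m ns) |m. 1 \<le> m \<and> m < length ns}"
  have T: "i \<in> T \<longleftrightarrow> (\<exists>m. i = ps m \<and> 1 \<le> m \<and> m < length ns)" for i
    by (simp add: T_def ps_def)
  have im: "(\<lambda>m. ps (Suc m)) ` {0..<length ns} = {i \<in> {1..<Suc n}. i \<in> S \<or> i = n}"
    using arg_cong[OF assms(2), of set] by (simp only: ps_def set_map set_upt set_filter)
  have sums: "(\<exists>m<length ns. i = ps (Suc m)) \<longleftrightarrow> 1 \<le> i \<and> i \<le> n \<and> (i \<in> S \<or> i = n)" for i
  proof -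
    have "(\<exists>m<length ns. i = ps (Suc m)) \<longleftrightarrow> i \<in> (\<lambda>m. ps (Suc m)) ` {0..<length ns}" by auto
    also have "\<dots> \<longleftrightarrow> 1 \<le> i \<and> i \<le> n \<and> (i \<in> S \<or> i = n)" unfolding im by auto
    finally show ?thesis .
  qed
  have "i \<in> T \<longleftrightarrow> i \<in> S" if i: "1 \<le> i" "i < n" for i
  proof
    assume "i \<in> T"
    then obtain m where m: "i = ps m" "1 \<le> m" "m < length ns" using T by auto
    then obtain m' where "m = Suc m'" by (cases m) auto
    then have "\<exists>m<length ns. i = ps (Suc m)" using m Suc_lessD by blast
    then show "i \<in> S" unfolding sums using i by auto
  next
    assume "i \<in> S"
    then obtain m where m: "i = ps (Suc m)" "m < length ns" using sums i by (meson less_imp_le)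
    \<comment> \<open>The full sum \<open>n\<close> is a block end but not a break point; as
      \<open>i < n\<close>, the partial sum equal to \<open>i\<close> is a proper one.\<close>
    have "ps (length ns) = n" using assms(1) by (simp add: ps_def)
    then have "Suc m \<noteq> length ns" using i m(1) by auto
    then have "Suc m < length ns" using m(2) by simp
    then show "i \<in> T" using T m(1) by force
  qed
  then have "filter (\<lambda>i. i \<notin> T) [1..<n] = filter (\<lambda>i. i \<notin> S) [1..<n]"
    by (intro filter_cong refl) auto
  then show ?thesis
    by (simp only: woven_pi_def braid.pi_skip_def Let_def assms(1) T_def)
qed

text \<open>With \<open>S\<close> and \<open>n\<close> read as block ends, every factor elsewhere is
  trivial. Dropping those factors leaves one factor per block, in the required order.\<close>

lemma pi_skip_comb_woven:
  assumes n: "1 \<le> n" and q: "\<And>i. 1 \<le> i \<Longrightarrow> i \<le> n \<Longrightarrow> q i \<in> braid.P n i"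
    and q1: "\<And>i. 1 \<le> i \<Longrightarrow> i < n \<Longrightarrow> i \<notin> S \<Longrightarrow> q i = \<one>\<^bsub>braid_group n\<^esub>"
  shows "braid.pi_skip n S n \<otimes>\<^bsub>braid_group n\<^esub> braid.comb n q n \<in> woven n"
proof -
  obtain ns where ns: "\<forall>d \<in> set ns. 0 < d" "sum_list ns = n"
      "map (\<lambda>m. sum_list (take (Suc m) ns)) [0..<length ns] =
        filter (\<lambda>i. i \<in> S \<or> i = n) [1..<Suc n]"
    using composition_of_breakpoints[OF n] by blast
  let ?bs = "map (\<lambda>m. q (sum_list (take (Suc m) ns))) [0..<length ns]"
  have cl: "q i \<in> carrier (braid_group n)" if "1 \<le> i" "i \<le> n" for i
    using q[OF that] braid.P_closed[of i n] that by blast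
  have bs: "?bs = map q (filter (\<lambda>i. i \<in> S \<or> i = n) [1..<Suc n])"
    using arg_cong[OF ns(3), of "map q"] by (simp add: comp_def del: upt_Suc)
  have "list_mult (braid_group n) ?bs = braid.comb n q n"
    unfolding bs braid.comb_def
    by (rule braid.list_mult_filter_one) (use cl q1 in \<open>auto simp del: upt_Suc\<close>)
  moreover have "?bs ! m \<in> pure_j_braids n (sum_list (take (Suc m) ns))" if m: "m < length ns" for m
  proof -
    have "sum_list (take (Suc m) ns) \<in> set (map (\<lambda>m. sum_list (take (Suc m) ns)) [0..<length ns])"
      using m by auto
    then have "1 \<le> sum_list (take (Suc m) ns)" "sum_list (take (Suc m) ns) \<le> n"
      unfolding ns(3) by auto
    then show ?thesis using m q pure_j_braids_eq_P by simp
  qed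
  ultimately have "braid.pi_skip n S n \<otimes>\<^bsub>braid_group n\<^esub> braid.comb n q n \<in> woven_of_type ns"
    unfolding woven_of_type_def Let_def ns(2) woven_pi_eq_pi_skip[OF ns(2,3), symmetric]
    by (intro CollectI exI[of _ ?bs]) auto
  then have "braid.pi_skip n S n \<otimes>\<^bsub>braid_group n\<^esub> braid.comb n q n \<in> woven_k n (length ns)"
    unfolding woven_k_def using ns by blast
  \<comment> \<open>Each part is at least one, so the number of blocks stays within the range
    allowed in \<open>woven\<close>.\<close>
  moreover have "length ns \<le> sum_list ns" using ns(1)
    by (induction ns) (auto simp: Suc_le_eq)
  moreover have "ns \<noteq> []" using ns(2) n by auto
  ultimately show ?thesis using ns(2) by (auto simp: woven_def Suc_le_eq)
qed

theorem theorem1: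
  fixes n :: nat and \<beta> :: "braid_word set"
  assumes "1 \<le> n" and "\<beta> \<in> carrier (braid_group n)"
  shows "\<exists>\<gamma> \<in> carrier (braid_group n).
    inv\<^bsub>braid_group n\<^esub> \<gamma> \<otimes>\<^bsub>braid_group n\<^esub> \<beta> \<otimes>\<^bsub>braid_group n\<^esub> \<gamma> \<in> woven n"
proof -
  obtain \<gamma> S q where \<gamma>: "\<gamma> \<in> carrier (braid_group n)"
    and q: "\<forall>i. 1 \<le> i \<longrightarrow> i \<le> n \<longrightarrow> q i \<in> braid.P n i"
      "\<forall>i. 1 \<le> i \<longrightarrow> i < n \<longrightarrow> i \<notin> S \<longrightarrow> q i = \<one>\<^bsub>braid_group n\<^esub>"
    and eq: "braid.conj_by n \<gamma> \<beta> = braid.pi_skip n S n \<otimes>\<^bsub>braid_group n\<^esub> braid.comb n q n"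
    using braid.conj_to_pi_skip_comb[OF assms(1) braid_carrier assms(2)] by blast
  have "braid.conj_by n \<gamma> \<beta> \<in> woven n"
    unfolding eq using q assms(1) by (intro pi_skip_comb_woven) auto
  then show ?thesis
    \<comment> \<open>\<open>conj_by\<close> puts the inverse on the right, whereas the claim has it
      on the left; hence the inverse as witness.\<close>
    using \<gamma> by (intro bexI[of _ "inv\<^bsub>braid_group n\<^esub> \<gamma>"]) (simp_all add: braid.conj_by_def)
qed

end
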